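(* Let $\bar a_1<\bar a_2<\cdots<\bar a_n$ be positive reals, let $\epsilon>0$ and $a_i:=\epsilon\bar a_i$. Write $\bar A_i:=\bar a_1+\cdots+\bar a_i$, $\bar A_{i:j}:=\sum_{k=i}^j\bar a_k$, and for a permutation $\pi$ of $\{1,\dots,n\}$, $\bar A_{\pi(i)}:=\bar a_{\pi(1)}+\cdots+\bar a_{\pi(i)}$; also $A_n:=\epsilon\bar A_n$. Let the disruption intensity be $\lambda(t)=\bar\lambda f(t)$ with fixed $\bar\lambda>0$ and $f$ a positive differentiable function on $[0,\infty)$ with $f_-:=\inf_{t\ge0}f(t)>0$ and $f_+:=\sup_{t\ge0}f(t)<\infty$. (i) Suppose $f$ is strictly decreasing on $[0,A_n]$, and for every permutation $\pi\ne\mathrm{id}$, $$|f'(0)|>\frac{2\bar\lambda\left((f_+)^2\bar A_n\sum_{i=1}^n\bar a_i^2+(f_+)^2\frac34(\bar A_n)^3\right)}{\sum_{i=1}^n\bar a_i(\bar A_i)^2-\sum_{i=1}^n\bar a_{\pi(i)}(\bar A_{\pi(i)})^2}.$$ Then for all sufficiently small $\epsilon>0$, SPT is optimal: $M_{1:n}(0)<M_{\pi(1):\pi(n)}(0)$ for every $\pi\ne\mathrm{id}$. (ii) Suppose $f$ is strictly increasing on $[0,A_n]$, and for every permutation $\pi$ with $(\pi(1),\dots,\pi(n))\ne(n,n-1,\dots,1)$, $$f'(0)>\frac{2\bar\lambda\left((f_+)^2\bar A_n\sum_{i=1}^n\bar a_i^2+(f_+)^2\frac34(\bar A_n)^3\right)}{\sum_{i=1}^n\bar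 a_{\pi(i)}(\bar A_{\pi(i)})^2-\sum_{i=1}^n\bar a_{n+1-i}(\bar A_{n+1-i:n})^2}.$$ Then for all sufficiently small $\epsilon>0$, LPT is optimal: $M_{n:1}(0)<M_{\pi(1):\pi(n)}(0)$ for every such $\pi$.
   Context: Model: a single machine processes a finite batch of tasks one at a time in a fixed order. A task of length $c>0$ requires $c$ units of uninterrupted processing. Disruptions occur at the points of a non-homogeneous Poisson process on $[0,\infty)$ with intensity function $\lambda(t)$. If a disruption occurs while a task is being processed, all work on it is lost and that task is restarted from scratch at the disruption time (no repair time); a task is completed once it has been processed for $c$ consecutive time units with no disruption, and the machine then immediately starts the next task. For a permutation $\pi$ of $\{1,\dots,n\}$, $M_{\pi(1):\pi(n)}(t)$ denotes the expected time, measured from $t$, to complete all tasks in the order $a_{\pi(1)},\dots,a_{\pi(n)}$ when processing of $a_{\pi(1)}$ starts at time $t$; $M_{1:n}$ corresponds to the identity (SPT order) and $M_{n:1}$ to the order $a_n,\dots,a_1$ (LPT order). *)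

theory Defs
  imports "HOL-Probability.Probability"
begin

definition cum_int :: "(real \<Rightarrow> real) \<Rightarrow> real \<Rightarrow> real" where
  "cum_int lam t = integral {0..t} lam"

definition exp_seq :: "(nat \<Rightarrow> real) measure" where
  "exp_seq = (\<Pi>\<^sub>M k\<in>UNIV. density lborel (exponential_density 1))"

text \<open>The k-th point (k = 0,1,...) of the non-homogeneous Poisson process with intensity lam,
  obtained by the standard time change of a unit-rate Poisson process:
  t_k = Lambda^{-1}(E_0 + ... + E_k).\<close>
definition nhpp_point :: "(real \<Rightarrow> real) \<Rightarrow> (nat \<Rightarrow> real) \<Rightarrow> nat \<Rightarrow> real" where
  "nhpp_point lam \<omega> k = (THE s. 0 \<le> s \<and> cum_int lam s = (\<Sum>j\<le>k. \<omega> j))"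

text \<open>Completion time of a task of length c started at time s, given disruption times d:
  the task is (re)started at s and at every disruption after s, and it completes at r + c for
  the first such start point r whose window (r, r+c) contains no disruption.\<close>
definition complete_time :: "(nat \<Rightarrow> real) \<Rightarrow> real \<Rightarrow> real \<Rightarrow> real" where
  "complete_time d c s =
     Inf {r + c | r. (r = s \<or> (\<exists>k. d k = r \<and> s < r)) \<and> \<not> (\<exists>k. r < d k \<and> d k < r + c)}"

fun finish_time :: "(nat \<Rightarrow> real) \<Rightarrow> real list \<Rightarrow> real \<Rightarrow> real" where
  "finish_time d [] s = s"
| "finish_time d (c # cs) s = finish_time d cs (complete_time d c s)"

definition exp_makespan :: "(real \<Rightarrow> real) \<Rightarrow> real list \<Rightarrow> real \<Rightarrow> ennreal" where
  "exp_makespan lam cs t = (\<integral>\<^sup>+ \<omega>. ennreal (finish_time (nhpp_point lam \<omega>) cs t - t) \<partial>exp_seq)"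

definition task_seq :: "real \<Rightarrow> (nat \<Rightarrow> real) \<Rightarrow> nat \<Rightarrow> (nat \<Rightarrow> nat) \<Rightarrow> real list" where
  "task_seq eps abar n \<pi> = map (\<lambda>i. eps * abar (\<pi> i)) [1..<Suc n]"

definition rev_perm :: "nat \<Rightarrow> nat \<Rightarrow> nat" where
  "rev_perm n i = (if 1 \<le> i \<and> i \<le> n then n + 1 - i else i)"

end

theory Submission
  imports Defs
begin

text \<open>
  Up to its first disruption the process either finishes the current task or restarts afresh, and
  the exponential law is memoryless. Hence the expected remaining time M satisfies the renewal
  equation: M(c # cs, s) is the sum of the integral of lam(x) exp(-(Lam x - Lam s))
  (x - s + M(c # cs, x)) over [s, s + c] and of exp(-(Lam (s + c) - Lam s)) (c + M(cs, s + c)).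
  Bootstrapping this equation from M(cs, s) = sum c + o(eps) for tasks of length of order eps and
  start times s of order eps gives M to order eps^3. The terms of order 1 and 2, and those
  of order 3 involving lam(0), are symmetric in the tasks. The only term that depends on the order
  is lam'(0)/2 times the sum over i of A_(i-1) a_i^2, which is largest for the SPT and smallest
  for the LPT order, because a pair x < y contributes x y^2 if x comes first and y x^2 otherwise.
  Summing a_i A_i^2 instead changes this only by a symmetric term, so the bounds in the hypotheses
  force the derivative at 0 to be nonzero, and its sign decides.
\<close>

section \<open>The hazard rate and its disruption process\<close>

text \<open>The renewal equation is implicit: M(c # cs, x) also stands under the integral.
  Subtracting c + M(cs, s + c), the expected duration ahead if the current task is not disturbed,
  from the unknown leaves an equation in which the remainder is an integral over a window of length
  c = O(eps). Inserting an approximation with error o(eps^k) thus returns one with error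
  o(eps^(k+1)), and two passes lead from first to third order. Each pass needs M at all start times
  in the window, so the estimates are uniform over s in [0, K eps], and K grows by the length of the
  task when the induction moves to the rest of the list. The rate is only differentiable at 0, so
  its linear expansion carries an o(eps) error; hence all estimates have the form "for every eta >
  0, eventually". M is only known to be measurable and bounded in s, which is why the equation stays
  in integral form.\<close>

text \<open>The rate is extended to negative times, so that the cumulative rate is a bijection of the
  reals and no sign conditions on times are needed.\<close>

locale hazard =
  fixes lam Lam :: "real \<Rightarrow> real" and l u :: real
  assumes l_pos: "0 < l"
    and lam_lower: "l \<le> lam x"
    and lam_upper: "lam x \<le> u"
    and lam_cont: "continuous_on UNIV lam"
    and Lam_deriv: "(Lam has_real_derivative lam x) (at x)"
    and Lam_0: "Lam 0 = 0"
begin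

lemma lam_pos: "0 < lam x"
  using l_pos lam_lower[of x] by linarith

lemma u_pos: "0 < u"
  using lam_pos[of 0] lam_upper[of 0] by linarith

lemma Lam_diff:
  assumes "x \<le> y"
  obtains z where "x \<le> z" "z \<le> y" "Lam y - Lam x = lam z * (y - x)"
proof (cases "x = y")
  case True
  then show ?thesis using that[of x] by simp
next
  case False
  then have "x < y" using assms by simp
  from MVT2[OF this, of Lam lam] Lam_deriv obtain z where "x < z" "z < y"
    "Lam y - Lam x = (y - x) * lam z" by auto
  then show ?thesis using that[of z] by (simp add: mult.commute)
qed

lemma Lam_diff_upper: "x \<le> y \<Longrightarrow> Lam y - Lam x \<le> u * (y - x)"
  by (rule Lam_diff[of x y]) (auto intro: mult_right_mono lam_upper)

lemma Lam_diff_lower: "x \<le> y \<Longrightarrow> l * (y - x) \<le> Lam y - Lam x"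
  by (rule Lam_diff[of x y]) (auto intro: mult_right_mono lam_lower)

lemma Lam_strict_mono: "strict_mono Lam"
proof (rule strict_monoI)
  fix x y :: real assume "x < y"
  then have "0 < l * (y - x)" using l_pos by simp
  also have "\<dots> \<le> Lam y - Lam x" using Lam_diff_lower[of x y] \<open>x < y\<close> by simp
  finally show "Lam x < Lam y" by simp
qed

lemmas Lam_less_iff [simp] = strict_mono_less[OF Lam_strict_mono]
lemmas Lam_le_iff [simp] = strict_mono_less_eq[OF Lam_strict_mono]

lemma Lam_cont: "continuous_on A Lam"
  using Lam_deriv by (meson DERIV_isCont continuous_at_imp_continuous_on)

lemma Lam_borel [measurable]: "Lam \<in> borel_measurable borel"
  using Lam_cont by (rule borel_measurable_continuous_onI)

lemma lam_borel [measurable]: "lam \<in> borel_measurable borel"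
  using lam_cont by (rule borel_measurable_continuous_onI)

lemma Lam_surj: "\<exists>x. Lam x = y"
proof -
  \<comment> \<open>\<open>Lam\<close> has slope at least \<open>l\<close>, so on
    \<open>{-b..b}\<close> it already covers all values of modulus up to
    \<open>\<bar>y\<bar>\<close>.\<close>
  define b where "b = \<bar>y\<bar> / l"
  have b: "0 \<le> b" "l * b = \<bar>y\<bar>" using l_pos by (auto simp: b_def)
  have "\<exists>x\<ge>-b. x \<le> b \<and> Lam x = y"
    using Lam_diff_lower[of 0 b] Lam_diff_lower[of "-b" 0] b
    by (intro IVT') (auto simp: Lam_0 intro: Lam_cont)
  then show ?thesis by blast
qed

definition Linv :: "real \<Rightarrow> real" where "Linv = inv Lam"

lemma Lam_Linv [simp]: "Lam (Linv y) = y"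
  using Lam_surj[of y] by (metis Linv_def f_inv_into_f rangeI)

lemma Linv_Lam [simp]: "Linv (Lam x) = x"
  using Lam_Linv[of "Lam x"] strict_mono_eq[OF Lam_strict_mono] by blast

lemma Linv_less_iff [simp]: "Linv x < Linv y \<longleftrightarrow> x < y"
  by (metis Lam_Linv Lam_less_iff)

lemma Linv_le_iff [simp]: "Linv x \<le> Linv y \<longleftrightarrow> x \<le> y"
  by (metis Lam_Linv Lam_le_iff)

lemma Linv_borel [measurable]: "Linv \<in> borel_measurable borel"
  by (rule borel_measurable_mono) (simp add: mono_def)

lemma le_Linv_iff: "x \<le> Linv y \<longleftrightarrow> Lam x \<le> y"
  by (metis Lam_Linv Lam_le_iff)

lemma Linv_less_iff': "Linv y < x \<longleftrightarrow> y < Lam x"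
  by (metis Lam_Linv Lam_less_iff)

lemma less_Linv_iff: "x < Linv y \<longleftrightarrow> Lam x < y"
  by (metis Lam_Linv Lam_less_iff)

lemma Linv_le_iff': "Linv y \<le> x \<longleftrightarrow> y \<le> Lam x"
  by (metis Lam_Linv Lam_le_iff)

text \<open>With independent unit exponential increments, these are the disruption times after s.\<close>
definition points :: "real \<Rightarrow> (nat \<Rightarrow> real) \<Rightarrow> nat \<Rightarrow> real" where
  "points s \<omega> k = Linv (Lam s + (\<Sum>j\<le>k. \<omega> j))"

text \<open>Renewal at a disruption: what follows the first point is the same process started there,
  driven by the remaining increments.\<close>

lemma points_shift:
  "points s \<omega> (Suc k) = points (Linv (Lam s + \<omega> 0)) (\<lambda>k. \<omega> (Suc k)) k"
  unfolding points_def by (subst sum.atMost_Suc_shift) (simp add: add.assoc)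

text \<open>Disruption times are absolute, so observing them from \<open>s + c\<close> instead of
  \<open>s\<close> changes only the account: the hazard already spent is deducted from the first
  increment. With memorylessness this is the renewal at a completed task.\<close>

lemma points_residual:
  "points (s + c) (case_nat (\<omega> 0 - (Lam (s + c) - Lam s)) (\<lambda>k. \<omega> (Suc k))) = points s \<omega>"
proof
  fix k
  have eq: "(\<Sum>j\<le>k. case_nat (\<omega> 0 - (Lam (s + c) - Lam s)) (\<lambda>k. \<omega> (Suc k)) j)
      = (\<Sum>j\<le>k. \<omega> j) - (Lam (s + c) - Lam s)"
    by (cases k) (simp_all add: sum.atMost_Suc_shift del: sum.atMost_Suc)
  show "points (s + c) (case_nat (\<omega> 0 - (Lam (s + c) - Lam s)) (\<lambda>k. \<omega> (Suc k))) k = points s \<omega> k"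
    unfolding points_def eq by (simp add: add.commute)
qed

end

section \<open>Completion times along a fixed sequence of disruptions\<close>

lemma complete_time_undisturbed:
  assumes "0 < c" "\<And>k. s + c \<le> d k"
  shows "complete_time d c s = s + c"
  unfolding complete_time_def
proof (rule cInf_eq_minimum)
  show "s + c \<in> {r + c |r. (r = s \<or> (\<exists>k. d k = r \<and> s < r)) \<and> \<not> (\<exists>k. r < d k \<and> d k < r + c)}"
    using assms by (force simp: not_less)
qed auto

text \<open>If \<open>s < d 0\<close>, the window from \<open>s\<close> contains \<open>d 0\<close>,
  so \<open>s\<close> drops out as a starting point; if \<open>s = d 0\<close>, both sides start at
  the same time. No open window starting at or after \<open>d 0\<close> contains \<open>d 0\<close>,
  so the first point can be removed.\<close>

lemma complete_time_disturbed:
  assumes "strict_mono d" "s \<le> d 0" "d 0 < s + c"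
  shows "complete_time d c s = complete_time (\<lambda>k. d (Suc k)) c (d 0)"
proof -
  have less: "d 0 < d (Suc k)" for k
    using assms(1) by (simp add: strict_mono_less)
  have all: "(\<exists>k. P k) \<longleftrightarrow> P 0 \<or> (\<exists>k. P (Suc k))" for P :: "nat \<Rightarrow> bool"
    by (metis not0_implies_Suc)
  have "((r = s \<or> (\<exists>k. d k = r \<and> s < r)) \<and> \<not> (\<exists>k. r < d k \<and> d k < r + c)) \<longleftrightarrow>
    ((r = d 0 \<or> (\<exists>k. d (Suc k) = r \<and> d 0 < r)) \<and> \<not> (\<exists>k. r < d (Suc k) \<and> d (Suc k) < r + c))" for r
    using less assms(2,3)
    unfolding all[of "\<lambda>k. d k = r \<and> s < r"] all[of "\<lambda>k. r < d k \<and> d k < r + c"]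
    by (smt (verit))
  then show ?thesis unfolding complete_time_def by simp
qed

lemma complete_time_forget:
  assumes "d 0 \<le> s"
  shows "complete_time (\<lambda>k. d (Suc k)) c s = complete_time d c s"
proof -
  have all: "(\<exists>k. P k) \<longleftrightarrow> P 0 \<or> (\<exists>k. P (Suc k))" for P :: "nat \<Rightarrow> bool"
    by (metis not0_implies_Suc)
  have "((r = s \<or> (\<exists>k. d k = r \<and> s < r)) \<and> \<not> (\<exists>k. r < d k \<and> d k < r + c)) \<longleftrightarrow>
    ((r = s \<or> (\<exists>k. d (Suc k) = r \<and> s < r)) \<and> \<not> (\<exists>k. r < d (Suc k) \<and> d (Suc k) < r + c))" for r
    using assms
    unfolding all[of "\<lambda>k. d k = r \<and> s < r"] all[of "\<lambda>k. r < d k \<and> d k < r + c"]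
    by (smt (verit))
  then show ?thesis unfolding complete_time_def by simp
qed

text \<open>Without wide gaps the infimum in \<^const>\<open>complete_time\<close> may be over the empty set, where it
  has a junk value.\<close>
definition wide_gaps :: "(nat \<Rightarrow> real) \<Rightarrow> bool" where
  "wide_gaps d \<longleftrightarrow> strict_mono d \<and> (\<forall>T C. \<exists>k. T < d k \<and> d k + C \<le> d (Suc k))"

lemma complete_time_ge:
  assumes "wide_gaps d"
  shows "s + c \<le> complete_time d c s"
  unfolding complete_time_def
proof (rule cInf_greatest)
  \<comment> \<open>A gap of length \<open>c\<close> after \<open>s\<close> provides an element of
    the set, as \<open>cInf_greatest\<close> demands.\<close>
  obtain k where k: "s < d k" "d k + c \<le> d (Suc k)"
    using assms unfolding wide_gaps_def by blast
  have "\<not> (d k < d j \<and> d j < d k + c)" for j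
  proof
    assume "d k < d j \<and> d j < d k + c"
    then have "d k < d j" "d j < d (Suc k)" using k by auto
    with assms have "k < j" "j < Suc k" by (auto simp: wide_gaps_def strict_mono_less)
    then show False by simp
  qed
  then have "d k + c \<in> {r + c |r. (r = s \<or> (\<exists>k. d k = r \<and> s < r)) \<and> \<not> (\<exists>k. r < d k \<and> d k < r + c)}"
    using k by blast
  then show "{r + c |r. (r = s \<or> (\<exists>k. d k = r \<and> s < r)) \<and> \<not> (\<exists>k. r < d k \<and> d k < r + c)} \<noteq> {}"
    by blast
qed auto

lemma finish_time_ge:
  assumes "wide_gaps d" "\<forall>c\<in>set cs. 0 \<le> c"
  shows "s \<le> finish_time d cs s"
  using assms(2)
proof (induction cs arbitrary: s)
  case (Cons c cs)
  then have "complete_time d c s \<le> finish_time d cs (complete_time d c s)" "0 \<le> c" by auto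
  then show ?case using complete_time_ge[OF assms(1), of s c] by simp
qed simp

text \<open>After a disruption the recursion for durations sees only the shifted sequence, while
  \<open>finish_time\<close> keeps the full one for the later tasks. Start times never decrease, so
  a point in the past stays irrelevant.\<close>

lemma finish_time_forget:
  assumes "wide_gaps d" "\<forall>c\<in>set cs. 0 \<le> c" "d 0 \<le> s"
  shows "finish_time (\<lambda>k. d (Suc k)) cs s = finish_time d cs s"
  using assms(2,3)
proof (induction cs arbitrary: s)
  case (Cons c cs)
  then show ?case
    using complete_time_ge[OF assms(1), of s c] complete_time_forget[of d s c]
    by simp
qed simp

section \<open>Pathwise renewal recursion and its agreement with the finish time\<close>

context hazard
begin

text \<open>Almost every path is of this kind. The first increment may be 0, since a residual
  waiting time can vanish; the infinitely many large increments are what yields wide gaps.\<close>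

definition good :: "(nat \<Rightarrow> real) \<Rightarrow> bool" where
  "good \<omega> \<longleftrightarrow> 0 \<le> \<omega> 0 \<and> (\<forall>k. 0 < \<omega> (Suc k)) \<and> (\<forall>N C. \<exists>k\<ge>N. C < \<omega> k)"

lemma good_nonneg: "good \<omega> \<Longrightarrow> 0 \<le> \<omega> k"
  by (cases k) (auto simp: good_def intro: less_imp_le)

lemma good_shift: "good \<omega> \<Longrightarrow> good (\<lambda>k. \<omega> (Suc k))"
  unfolding good_def by (metis Suc_le_D Suc_le_mono less_imp_le)

lemma good_residual: 
  assumes "good \<omega>" "0 \<le> x" 
  shows "good (case_nat x (\<lambda>k. \<omega> (Suc k)))"
  unfolding good_def
proof (intro conjI allI)
  fix N :: nat and C :: real
  obtain k where "Suc N \<le> k" "C < \<omega> k" using assms(1) unfolding good_def by blast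
  then show "\<exists>k\<ge>N. C < (case k of 0 \<Rightarrow> x | Suc k \<Rightarrow> \<omega> (Suc k))"
    by (intro exI[of _ k]) (auto split: nat.split)
qed (use assms in \<open>auto simp: good_def\<close>)

lemma wide_gaps_points:
  assumes "good \<omega>"
  shows "wide_gaps (points s \<omega>)"
  unfolding wide_gaps_def
proof (intro conjI allI)
  show mono: "strict_mono (points s \<omega>)"
    using assms by (auto simp: strict_mono_Suc_iff points_def good_def)
  fix T C :: real
  obtain N where N: "\<bar>Lam T - Lam s\<bar> < \<omega> N"
    using assms unfolding good_def by blast
  \<comment> \<open>Increment \<open>N\<close> carries all later points past \<open>T\<close>.
    Searching from \<open>Suc N\<close> on gives the next large increment a predecessor
    \<open>j \<ge> N\<close>. The hazard over a gap is at most \<open>u\<close> times its length, so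
    an increment above \<open>u * \<bar>C\<bar>\<close> forces a gap of length at least
    \<open>\<bar>C\<bar>\<close>.\<close>
  obtain k where k: "Suc N \<le> k" "u * \<bar>C\<bar> < \<omega> k"
    using assms unfolding good_def by blast
  then obtain j where j: "k = Suc j" "N \<le> j" by (metis Suc_le_D Suc_le_mono)
  have "\<omega> N \<le> (\<Sum>i\<le>N. \<omega> i)"
    using good_nonneg[OF assms] by (intro member_le_sum) auto
  also have "\<dots> \<le> (\<Sum>i\<le>j. \<omega> i)"
    using good_nonneg[OF assms] j by (intro sum_mono2) auto
  finally have T: "T < points s \<omega> j" using N by (simp add: points_def less_Linv_iff)
  have "\<omega> (Suc j) = Lam (points s \<omega> (Suc j)) - Lam (points s \<omega> j)"
    by (simp add: points_def)
  also have "\<dots> \<le> u * (points s \<omega> (Suc j) - points s \<omega> j)"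
    using mono by (intro Lam_diff_upper) (simp add: strict_mono_less_eq)
  finally have "u * \<bar>C\<bar> \<le> u * (points s \<omega> (Suc j) - points s \<omega> j)" using k j by simp
  then have "\<bar>C\<bar> \<le> points s \<omega> (Suc j) - points s \<omega> j" using u_pos by simp
  then show "\<exists>k. T < points s \<omega> k \<and> points s \<omega> k + C \<le> points s \<omega> (Suc k)"
    using T by (intro exI[of _ j]) auto
qed

text \<open>One renewal: either a disruption hits the current task of length c, or it completes and the
  waiting time for the next disruption is reduced by what has elapsed. Here \<Phi> and \<Psi> give the
  remaining duration in the two cases.\<close>
definition step :: "real \<Rightarrow> (real \<Rightarrow> (nat \<Rightarrow> real) \<Rightarrow> ennreal) \<Rightarrow> (real \<Rightarrow> (nat \<Rightarrow> real) \<Rightarrow> ennreal)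
    \<Rightarrow> real \<Rightarrow> (nat \<Rightarrow> real) \<Rightarrow> ennreal" where
  "step c \<Phi> \<Psi> s \<omega> =
    (if \<omega> 0 < Lam (s + c) - Lam s
     then ennreal (Linv (Lam s + \<omega> 0) - s) + \<Phi> (Linv (Lam s + \<omega> 0)) (\<lambda>k. \<omega> (Suc k))
     else ennreal c + \<Psi> (s + c) (case_nat (\<omega> 0 - (Lam (s + c) - Lam s)) (\<lambda>k. \<omega> (Suc k))))"

text \<open>The first argument bounds the number of disruptions followed. The stages increase to the true
  duration, which gives measurability and integrability without any a priori finiteness.\<close>
fun stage :: "nat \<Rightarrow> real list \<Rightarrow> real \<Rightarrow> (nat \<Rightarrow> real) \<Rightarrow> ennreal" where
  "stage 0 cs = (\<lambda>s \<omega>. 0)"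
| "stage (Suc j) [] = (\<lambda>s \<omega>. 0)"
| "stage (Suc j) (c # cs) = step c (stage j (c # cs)) (stage (Suc j) cs)"

definition dur :: "real list \<Rightarrow> real \<Rightarrow> (nat \<Rightarrow> real) \<Rightarrow> ennreal" where
  "dur cs s \<omega> = (SUP j. stage j cs s \<omega>)"

lemma step_mono:
  "(\<And>s \<omega>. \<Phi> s \<omega> \<le> \<Phi>' s \<omega>) \<Longrightarrow> (\<And>s \<omega>. \<Psi> s \<omega> \<le> \<Psi>' s \<omega>) \<Longrightarrow> step c \<Phi> \<Psi> s \<omega> \<le> step c \<Phi>' \<Psi>' s \<omega>"
  by (auto simp: step_def)

lemma stage_mono_Suc: "stage j cs s \<omega> \<le> stage (Suc j) cs s \<omega>"
proof (induction j cs arbitrary: s \<omega> rule: stage.induct)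
  case (3 j c cs)
  then show ?case by (auto intro!: step_mono)
qed auto

lemma incseq_stage: "incseq (\<lambda>j. stage j cs s \<omega>)"
  by (simp add: incseq_SucI stage_mono_Suc)

lemma dur_Suc: "dur cs s \<omega> = (SUP j. stage (Suc j) cs s \<omega>)"
  unfolding dur_def
  by (rule antisym) (auto intro!: SUP_mono stage_mono_Suc)

lemma dur_Nil [simp]: "dur [] s \<omega> = 0"
  by (simp add: dur_Suc)

text \<open>For a fixed path only one branch of \<open>step\<close> is active, and both merely add a
  constant, so the supremum passes through. The branches run at the indices \<open>j\<close> and
  \<open>Suc j\<close>, hence the two representations of \<open>dur\<close>.\<close>

lemma dur_Cons: "dur (c # cs) s \<omega> = step c (dur (c # cs)) (dur cs) s \<omega>"
proof -
  have "dur (c # cs) s \<omega> = (SUP j. step c (stage j (c # cs)) (stage (Suc j) cs) s \<omega>)"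
    by (simp add: dur_Suc)
  also have "\<dots> = step c (dur (c # cs)) (dur cs) s \<omega>"
  proof (cases "\<omega> 0 < Lam (s + c) - Lam s")
    case True
    then show ?thesis by (simp add: step_def dur_def ennreal_SUP_add_right)
  next
    case False
    then show ?thesis by (simp add: step_def dur_Suc[of cs] ennreal_SUP_add_right)
  qed
  finally show ?thesis .
qed

lemma dur_eq_finish_time:
  assumes "good \<omega>" "\<forall>c\<in>set cs. 0 < c"
  shows "dur cs s \<omega> = ennreal (finish_time (points s \<omega>) cs s - s)"
  using assms
proof (induction cs arbitrary: s \<omega>)
  case (Cons c cs)
  have c: "0 < c" and nn: "\<forall>c\<in>set cs. 0 \<le> c" using Cons.prems(2) by auto
  have undisturbed: "dur (c # cs) s \<omega> = ennreal (finish_time (points s \<omega>) (c # cs) s - s)"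
    if good: "good \<omega>" and L: "Lam (s + c) - Lam s \<le> \<omega> 0" for s \<omega>
  proof -
    let ?\<omega> = "case_nat (\<omega> 0 - (Lam (s + c) - Lam s)) (\<lambda>k. \<omega> (Suc k))"
    have "good ?\<omega>" using good_residual[OF good] L by simp
    have mono: "strict_mono (points s \<omega>)"
      using wide_gaps_points[OF good] by (simp add: wide_gaps_def)
    have "s + c \<le> points s \<omega> 0" using L by (simp add: points_def le_Linv_iff)
    then have "s + c \<le> points s \<omega> k" for k
      using strict_mono_less_eq[OF mono, of 0 k] by simp
    then have ct: "complete_time (points s \<omega>) c s = s + c"
      using c by (intro complete_time_undisturbed)
    have ge: "s + c \<le> finish_time (points s \<omega>) cs (s + c)"
      using wide_gaps_points[OF good] nn by (rule finish_time_ge)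
    have "dur (c # cs) s \<omega> = ennreal c + dur cs (s + c) ?\<omega>"
      using L by (simp add: dur_Cons[of c] step_def)
    also have "dur cs (s + c) ?\<omega> = ennreal (finish_time (points s \<omega>) cs (s + c) - (s + c))"
      using Cons.IH[OF \<open>good ?\<omega>\<close>] Cons.prems(2) by (simp add: points_residual)
    also have "ennreal c + \<dots> = ennreal (finish_time (points s \<omega>) (c # cs) s - s)"
      using ge c by (simp add: ct flip: ennreal_plus)
    finally show ?thesis .
  qed
  \<comment> \<open>Inner induction: \<open>N\<close> is the position of an increment exceeding the
    hazard of any window of length \<open>c\<close>. Every disruption drops one increment and lowers
    \<open>N\<close>, and at \<open>N = 0\<close> the task must complete.\<close>
  have "dur (c # cs) s \<omega> = ennreal (finish_time (points s \<omega>) (c # cs) s - s)"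
    if "good \<omega>" "u * c < \<omega> N" for N s \<omega>
    using that
  proof (induction N arbitrary: s \<omega>)
    case (0 s \<omega>)
    then show ?case using Lam_diff_upper[of s "s + c"] c by (intro undisturbed) auto
  next
    case (Suc N s \<omega>)
    show ?case
    proof (cases "\<omega> 0 < Lam (s + c) - Lam s")
      case True
      let ?x = "Linv (Lam s + \<omega> 0)" and ?\<omega> = "\<lambda>k. \<omega> (Suc k)"
      note wide = wide_gaps_points[OF Suc.prems(1), of s]
      have x0: "points s \<omega> 0 = ?x" by (simp add: points_def)
      have x: "s \<le> ?x" "?x < s + c"
        using True good_nonneg[OF Suc.prems(1), of 0] by (auto simp: le_Linv_iff Linv_less_iff')
      have pts: "points ?x ?\<omega> = (\<lambda>k. points s \<omega> (Suc k))"
        by (simp add: points_shift fun_eq_iff)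
      have ct: "complete_time (points s \<omega>) c s = complete_time (\<lambda>k. points s \<omega> (Suc k)) c ?x"
        using wide x by (subst complete_time_disturbed) (auto simp: wide_gaps_def x0)
      have "?x + c \<le> complete_time (\<lambda>k. points s \<omega> (Suc k)) c ?x"
        using wide_gaps_points[OF good_shift[OF Suc.prems(1)], of ?x] complete_time_ge pts by metis
      \<comment> \<open>The task completes at or after \<open>?x + c\<close>, hence after the first
        point, which the remaining tasks can therefore forget.\<close>
      then have fin: "finish_time (\<lambda>k. points s \<omega> (Suc k)) cs (complete_time (points s \<omega>) c s)
          = finish_time (points s \<omega>) cs (complete_time (points s \<omega>) c s)"
        using wide nn c by (intro finish_time_forget) (auto simp: x0 ct)
      have ge: "?x \<le> finish_time (points ?x ?\<omega>) (c # cs) ?x"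
        using wide_gaps_points[OF good_shift[OF Suc.prems(1)], of ?x] nn c
        by (intro finish_time_ge) auto
      have "dur (c # cs) s \<omega> = ennreal (?x - s) + dur (c # cs) ?x ?\<omega>"
        using True by (simp add: dur_Cons[of c _ s] step_def)
      also have "dur (c # cs) ?x ?\<omega> = ennreal (finish_time (points ?x ?\<omega>) (c # cs) ?x - ?x)"
        using Suc.prems by (intro Suc.IH good_shift) auto
      also have "ennreal (?x - s) + \<dots> = ennreal (finish_time (points ?x ?\<omega>) (c # cs) ?x - s)"
        using ge x by (simp flip: ennreal_plus)
      also have "finish_time (points ?x ?\<omega>) (c # cs) ?x = finish_time (points s \<omega>) (c # cs) s"
        using fin by (simp add: pts ct)
      finally show ?thesis .
    next
      case False
      with Suc.prems show ?thesis by (intro undisturbed) auto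
    qed
  qed
  moreover obtain N where "u * c < \<omega> N" using Cons.prems(1) unfolding good_def by blast
  ultimately show ?case using Cons.prems(1) by blast
qed simp

end

section \<open>Sequences of exponential waiting times\<close>

definition exp_law :: "real measure" where
  "exp_law = density lborel (exponential_density 1)"

lemma exp_seq_eq: "exp_seq = (\<Pi>\<^sub>M k\<in>UNIV. exp_law)"
  by (simp add: exp_seq_def exp_law_def)

lemma sets_exp_law [simp, measurable_cong]: "sets exp_law = sets borel"
  by (simp add: exp_law_def)

lemma space_exp_law [simp]: "space exp_law = UNIV"
  by (simp add: exp_law_def)

interpretation exp_law: prob_space exp_law
  unfolding exp_law_def by (rule prob_space_exponential_density) simp

lemma emeasure_exp_law_UNIV [simp]: "emeasure exp_law UNIV = 1"
  using exp_law.emeasure_space_1 by simp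

interpretation sequence_space exp_law ..

lemma sets_exp_seq [measurable_cong]: "sets exp_seq = sets (\<Pi>\<^sub>M k\<in>(UNIV::nat set). (borel :: real measure))"
  unfolding exp_seq_eq by (intro sets_PiM_cong) auto

lemma space_exp_seq [simp]: "space exp_seq = UNIV"
  by (simp add: exp_seq_eq space_PiM)

interpretation exp_seq: prob_space exp_seq
  unfolding exp_seq_eq by (rule P.prob_space_axioms)

lemma emeasure_exp_seq_UNIV [simp]: "emeasure exp_seq UNIV = 1"
  using exp_seq.emeasure_space_1 by simp

lemma measurable_component_exp_seq: "(\<lambda>\<omega>. \<omega> k) \<in> borel_measurable exp_seq"
  by measurable

lemma measurable_shift_exp_seq: "(\<lambda>\<omega> k. \<omega> (Suc k)) \<in> exp_seq \<rightarrow>\<^sub>M exp_seq"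
  unfolding measurable_cong_sets[OF sets_exp_seq sets_exp_seq]
  by (rule measurable_PiM_single') (auto simp: space_PiM)

lemma measurable_exp_lawI: "f \<in> borel_measurable N \<Longrightarrow> f \<in> N \<rightarrow>\<^sub>M exp_law"
  by (subst measurable_cong_sets[OF refl sets_exp_law])

lemma measurable_cons_exp_seq:
  assumes f: "f \<in> borel_measurable N" and g: "g \<in> N \<rightarrow>\<^sub>M exp_seq"
  shows "(\<lambda>x. case_nat (f x) (g x)) \<in> N \<rightarrow>\<^sub>M exp_seq"
  by (rule measurable_case_nat'[OF measurable_exp_lawI[OF f] g[unfolded exp_seq_eq], folded exp_seq_eq])

text \<open>The law of an i.i.d. sequence is unchanged when an independent copy of a coordinate is
  put in front (\<open>PiM_iter\<close>); Fubini then integrates the first coordinate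
  separately.\<close>

lemma nn_integral_exp_seq_cons:
  assumes [measurable]: "f \<in> borel_measurable exp_seq"
  shows "(\<integral>\<^sup>+\<omega>. f \<omega> \<partial>exp_seq) = (\<integral>\<^sup>+e. \<integral>\<^sup>+\<omega>. f (case_nat e \<omega>) \<partial>exp_seq \<partial>exp_law)"
proof -
  have "(\<integral>\<^sup>+\<omega>. f \<omega> \<partial>exp_seq)
      = (\<integral>\<^sup>+\<omega>. f \<omega> \<partial>distr (exp_law \<Otimes>\<^sub>M exp_seq) exp_seq (\<lambda>(s, \<omega>). case_nat s \<omega>))"
    using PiM_iter by (simp add: exp_seq_eq)
  also have "\<dots> = (\<integral>\<^sup>+x. f (case_nat (fst x) (snd x)) \<partial>(exp_law \<Otimes>\<^sub>M exp_seq))"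
    by (subst nn_integral_distr) (auto simp: case_prod_beta)
  also have "\<dots> = (\<integral>\<^sup>+e. \<integral>\<^sup>+\<omega>. f (case_nat e \<omega>) \<partial>exp_seq \<partial>exp_law)"
    by (subst exp_seq.nn_integral_fst[symmetric]) (auto simp: case_prod_beta)
  finally show ?thesis .
qed

lemma nn_integral_exp_law:
  assumes [measurable]: "h \<in> borel_measurable borel"
  shows "(\<integral>\<^sup>+e. h e \<partial>exp_law) = (\<integral>\<^sup>+e. h e * ennreal (exp (- e)) * indicator {0..} e \<partial>lborel)"
  unfolding exp_law_def
  by (subst nn_integral_density)
    (auto intro!: nn_integral_cong simp: exponential_density_def indicator_def mult.commute)

lemma exp_law_memoryless:
  assumes [measurable]: "h \<in> borel_measurable borel" and L: "0 \<le> L"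
  shows "(\<integral>\<^sup>+e. h (e - L) * indicator {L..} e \<partial>exp_law) = ennreal (exp (- L)) * (\<integral>\<^sup>+e. h e \<partial>exp_law)"
proof -
  have "(\<integral>\<^sup>+e. h (e - L) * indicator {L..} e \<partial>exp_law)
      = (\<integral>\<^sup>+e. h (e - L) * indicator {L..} e * ennreal (exp (- e)) * indicator {0..} e \<partial>lborel)"
    by (rule nn_integral_exp_law) measurable
  also have "\<dots> = (\<integral>\<^sup>+e. h e * indicator {L..} (L + e) * ennreal (exp (- (L + e))) * indicator {0..} (L + e) \<partial>lborel)"
    by (subst nn_integral_real_affine[where c = 1 and t = L]) auto
  also have "\<dots> = (\<integral>\<^sup>+e. ennreal (exp (- L)) * (h e * ennreal (exp (- e)) * indicator {0..} e) \<partial>lborel)"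
  proof (rule nn_integral_cong)
    fix e :: real
    have "ennreal (exp (- (L + e))) = ennreal (exp (- L)) * ennreal (exp (- e))"
      by (simp add: exp_diff exp_minus field_simps flip: ennreal_mult)
    then show "h e * indicator {L..} (L + e) * ennreal (exp (- (L + e))) * indicator {0..} (L + e)
        = ennreal (exp (- L)) * (h e * ennreal (exp (- e)) * indicator {0..} e)"
      using L by (simp add: indicator_def mult_ac)
  qed
  also have "\<dots> = ennreal (exp (- L)) * (\<integral>\<^sup>+e. h e \<partial>exp_law)"
    by (subst nn_integral_cmult) (auto simp: nn_integral_exp_law)
  finally show ?thesis .
qed

lemma AE_exp_law_pos: "AE e in exp_law. 0 < e"
proof -
  have "AE e in lborel. e \<noteq> (0::real)" by (rule AE_lborel_singleton)
  then show ?thesis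
    unfolding exp_law_def by (subst AE_density) (auto simp: exponential_density_def)
qed

lemma AE_exp_seq_pos: "AE \<omega> in exp_seq. \<forall>k. 0 < \<omega> k"
  unfolding exp_seq_eq AE_all_countable
  by (intro allI AE_PiM_component exp_law.prob_space_axioms AE_exp_law_pos) auto

lemma exp_law_atMost_less_1: "emeasure exp_law {..C} < 1"
proof -
  have "emeasure exp_law {C<..} \<noteq> 0"
  proof
    assume "emeasure exp_law {C<..} = 0"
    then have "AE e in exp_law. e \<notin> {C<..}" by (intro AE_not_in) auto
    then have "AE e in lborel. \<not> (max 0 C < e)"
      unfolding exp_law_def by (subst (asm) AE_density) (auto simp: exponential_density_def elim!: eventually_mono)
    then have "emeasure lborel {e. max 0 C < e \<and> e \<in> space lborel} = 0"
      by (subst (asm) AE_iff_measurable[where N = "{max 0 C<..}"]) (auto simp: greaterThan_def)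
    then have "emeasure lborel {max 0 C<..} = 0" by (simp add: greaterThan_def)
    moreover have "emeasure lborel {max 0 C<..max 0 C + 1} \<le> emeasure lborel {max 0 C<..}"
      by (intro emeasure_mono) auto
    ultimately show False by simp
  qed
  moreover have "{..C} = space exp_law - {C<..}" by auto
  ultimately have "emeasure exp_law {..C} \<noteq> 1"
    using exp_law.prob_compl[of "{C<..}"] by (simp add: exp_law.emeasure_eq_measure)
  then show ?thesis using exp_law.emeasure_le_1[of "{..C}"] by simp
qed

lemma bounded_tail_sets [measurable]: "{\<omega>. \<forall>k\<ge>N. \<omega> k \<le> C} \<in> sets exp_seq"
proof -
  have "{\<omega> \<in> space exp_seq. \<forall>k\<ge>N. \<omega> k \<le> C} \<in> sets exp_seq" by measurable
  then show ?thesis by simp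
qed

text \<open>Splitting off the first coordinate shows that the probability p of this event satisfies
  p = q p with q = P(e <= C) < 1; as p is finite, p = 0.\<close>

lemma exp_seq_bounded_null: "emeasure exp_seq {\<omega>. \<forall>k. \<omega> k \<le> C} = 0"
proof -
  define A where "A = {\<omega> :: nat \<Rightarrow> real. \<forall>k. \<omega> k \<le> C}"
  have A: "A \<in> sets exp_seq" using bounded_tail_sets[of 0 C] by (simp add: A_def)
  have "case_nat e \<omega> \<in> A \<longleftrightarrow> e \<in> {..C} \<and> \<omega> \<in> A" for e \<omega>
    by (auto simp: A_def split: nat.splits)
  then have ind: "indicator A (case_nat e \<omega>) = (indicator {..C} e * indicator A \<omega> :: ennreal)" for e \<omega>
    by (simp add: indicator_def)
  have "emeasure exp_seq A = (\<integral>\<^sup>+\<omega>. indicator A \<omega> \<partial>exp_seq)"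
    using A by (rule nn_integral_indicator[symmetric])
  also have "\<dots> = (\<integral>\<^sup>+e. \<integral>\<^sup>+\<omega>. indicator A (case_nat e \<omega>) \<partial>exp_seq \<partial>exp_law)"
    using A by (intro nn_integral_exp_seq_cons borel_measurable_indicator)
  also have "\<dots> = (\<integral>\<^sup>+e. indicator {..C} e * emeasure exp_seq A \<partial>exp_law)"
    by (simp only: ind nn_integral_cmult_indicator[OF A])
  also have "\<dots> = emeasure exp_law {..C} * emeasure exp_seq A"
    using nn_integral_multc[of "indicator {..C}" exp_law "emeasure exp_seq A"] nn_integral_indicator[of "{..C}" exp_law]
    by (metis atMost_borel borel_measurable_indicator sets_exp_law)
  finally have eq: "emeasure exp_seq A = emeasure exp_law {..C} * emeasure exp_seq A" .
  have lt: "emeasure exp_law {..C} * emeasure exp_seq A < 1 * emeasure exp_seq A"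
    if "emeasure exp_seq A \<noteq> 0"
  proof (rule ennreal_mult_strict_right_mono[OF exp_law_atMost_less_1])
    show "0 < emeasure exp_seq A" using that by (simp only: zero_less_iff_neq_zero not_False_eq_True)
    show "emeasure exp_seq A < \<top>" by (rule top.not_eq_extremum[THEN iffD1, OF exp_seq.emeasure_finite])
  qed
  have "emeasure exp_seq A = 0"
  proof (rule ccontr)
    assume "emeasure exp_seq A \<noteq> 0"
    from lt[OF this] show False unfolding mult_1 eq[symmetric] by (rule less_irrefl[THEN notE])
  qed
  then show ?thesis by (simp only: A_def)
qed

text \<open>The event for \<open>Suc N\<close> does not look at the first coordinate, so its
  probability is that of the event for \<open>N\<close>.\<close>

lemma exp_seq_bounded_tail_null: "emeasure exp_seq {\<omega>. \<forall>k\<ge>N. \<omega> k \<le> C} = 0"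
proof (induction N)
  case 0
  then show ?case using exp_seq_bounded_null[of C] by simp
next
  case (Suc N)
  have "(\<forall>k\<ge>Suc N. case_nat e \<omega> k \<le> C) \<longleftrightarrow> (\<forall>k\<ge>N. \<omega> k \<le> C)" for e \<omega>
    by (metis Suc_le_D Suc_le_mono old.nat.simps(5))
  then have ind: "indicator {\<omega>. \<forall>k\<ge>Suc N. \<omega> k \<le> C} (case_nat e \<omega>)
      = (indicator {\<omega>. \<forall>k\<ge>N. \<omega> k \<le> C} \<omega> :: ennreal)" for e \<omega>
    by (simp add: indicator_def)
  have "emeasure exp_seq {\<omega>. \<forall>k\<ge>Suc N. \<omega> k \<le> C}
      = (\<integral>\<^sup>+\<omega>. indicator {\<omega>. \<forall>k\<ge>Suc N. \<omega> k \<le> C} \<omega> \<partial>exp_seq)"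
    using bounded_tail_sets by (rule nn_integral_indicator[symmetric])
  also have "\<dots> = (\<integral>\<^sup>+e. \<integral>\<^sup>+\<omega>. indicator {\<omega>. \<forall>k\<ge>Suc N. \<omega> k \<le> C} (case_nat e \<omega>) \<partial>exp_seq \<partial>exp_law)"
    by (intro nn_integral_exp_seq_cons borel_measurable_indicator bounded_tail_sets)
  also have "\<dots> = 0"
    unfolding ind nn_integral_indicator[OF bounded_tail_sets] Suc.IH by simp
  finally show ?case .
qed

lemma AE_exp_seq_unbounded: "AE \<omega> in exp_seq. \<forall>N C. \<exists>k\<ge>N. C < \<omega> k"
proof -
  have "AE \<omega> in exp_seq. \<exists>k\<ge>N. real m < \<omega> k" for N m
    by (rule AE_I'[of "{\<omega>. \<forall>k\<ge>N. \<omega> k \<le> real m}"])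
       (auto simp: null_sets_def bounded_tail_sets exp_seq_bounded_tail_null not_less)
  then have "AE \<omega> in exp_seq. \<forall>N m. \<exists>k\<ge>N. real m < \<omega> k"
    by (simp add: AE_all_countable)
  then show ?thesis
  proof eventually_elim
    case (elim \<omega>)
    then show ?case by (meson reals_Archimedean2 less_trans)
  qed
qed

lemma measurable_uncurried_comp:
  assumes "case_prod \<Phi> \<in> borel_measurable (borel \<Otimes>\<^sub>M exp_seq)"
    and "f \<in> borel_measurable N" "g \<in> N \<rightarrow>\<^sub>M exp_seq"
  shows "(\<lambda>x. \<Phi> (f x) (g x)) \<in> borel_measurable N"
  using measurable_compose[OF measurable_Pair[OF assms(2,3)] assms(1)] by simp

section \<open>Measurability of durations and one renewal in expectation\<close>

context hazard
begin

lemma AE_good: "AE \<omega> in exp_seq. good \<omega>"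
  using AE_exp_seq_pos AE_exp_seq_unbounded
  by eventually_elim (auto simp: good_def less_imp_le)

lemma step_measurable:
  assumes \<Phi>: "case_prod \<Phi> \<in> borel_measurable (borel \<Otimes>\<^sub>M exp_seq)"
    and \<Psi>: "case_prod \<Psi> \<in> borel_measurable (borel \<Otimes>\<^sub>M exp_seq)"
  shows "case_prod (step c \<Phi> \<Psi>) \<in> borel_measurable (borel \<Otimes>\<^sub>M exp_seq)"
proof -
  let ?N = "borel \<Otimes>\<^sub>M exp_seq :: (real \<times> (nat \<Rightarrow> real)) measure"
  have [measurable]: "(\<lambda>x. snd x 0) \<in> borel_measurable ?N"
    by (rule measurable_compose[OF measurable_snd measurable_component_exp_seq])
  have tail: "(\<lambda>x k. snd x (Suc k)) \<in> ?N \<rightarrow>\<^sub>M exp_seq"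
    by (rule measurable_compose[OF measurable_snd measurable_shift_exp_seq])
  have [measurable]: "(\<lambda>x. \<Phi> (Linv (Lam (fst x) + snd x 0)) (\<lambda>k. snd x (Suc k))) \<in> borel_measurable ?N"
    by (rule measurable_uncurried_comp[OF \<Phi> _ tail]) measurable
  have cons: "(\<lambda>x. case_nat (snd x 0 - (Lam (fst x + c) - Lam (fst x))) (\<lambda>k. snd x (Suc k))) \<in> ?N \<rightarrow>\<^sub>M exp_seq"
    by (rule measurable_cons_exp_seq[OF _ tail]) measurable
  have [measurable]: "(\<lambda>x. \<Psi> (fst x + c) (case_nat (snd x 0 - (Lam (fst x + c) - Lam (fst x)))
      (\<lambda>k. snd x (Suc k)))) \<in> borel_measurable ?N"
    by (rule measurable_uncurried_comp[OF \<Psi> _ cons]) measurable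
  show ?thesis unfolding step_def case_prod_unfold by measurable
qed

lemma stage_measurable: "case_prod (stage j cs) \<in> borel_measurable (borel \<Otimes>\<^sub>M exp_seq)"
  by (induction j cs rule: stage.induct) (simp_all add: step_measurable)

lemma dur_measurable: "case_prod (dur cs) \<in> borel_measurable (borel \<Otimes>\<^sub>M exp_seq)"
proof -
  have [measurable]: "(\<lambda>x. stage j cs (fst x) (snd x)) \<in> borel_measurable (borel \<Otimes>\<^sub>M exp_seq)" for j
    by (rule measurable_uncurried_comp[OF stage_measurable]) auto
  show ?thesis unfolding dur_def case_prod_unfold by measurable
qed

text \<open>Conditioning on the first increment \<open>e\<close>: for \<open>e < L\<close> the tail
  is fresh and independent of \<open>e\<close>; for \<open>e \<ge> L\<close> the residual
  \<open>e - L\<close> is again exponential, so prepending it to the tail gives a full sequence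
  again.\<close>

lemma nn_integral_step:
  fixes c s :: real
  assumes \<Phi>: "case_prod \<Phi> \<in> borel_measurable (borel \<Otimes>\<^sub>M exp_seq)"
    and \<Psi>: "case_prod \<Psi> \<in> borel_measurable (borel \<Otimes>\<^sub>M exp_seq)"
    and c: "0 \<le> c"
  defines "L \<equiv> Lam (s + c) - Lam s"
  shows "(\<integral>\<^sup>+\<omega>. step c \<Phi> \<Psi> s \<omega> \<partial>exp_seq) =
    (\<integral>\<^sup>+e. (ennreal (Linv (Lam s + e) - s) + (\<integral>\<^sup>+\<omega>. \<Phi> (Linv (Lam s + e)) \<omega> \<partial>exp_seq)) * indicator {..<L} e \<partial>exp_law)
    + ennreal (exp (- L)) * (ennreal c + (\<integral>\<^sup>+\<omega>. \<Psi> (s + c) \<omega> \<partial>exp_seq))"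
proof -
  have L: "0 \<le> L" using c by (simp add: L_def)
  have [measurable]: "step c \<Phi> \<Psi> s \<in> borel_measurable exp_seq"
    using step_measurable[OF \<Phi> \<Psi>, of c] by (rule measurable_uncurried_comp) auto
  have \<Phi>_sect [measurable]: "\<Phi> x \<in> borel_measurable exp_seq" for x
    using \<Phi> by (rule measurable_uncurried_comp) auto
  have \<Psi>_sect [measurable]: "\<Psi> x \<in> borel_measurable exp_seq" for x
    using \<Psi> by (rule measurable_uncurried_comp) auto
  let ?h = "\<lambda>e. \<integral>\<^sup>+\<omega>. (ennreal c + \<Psi> (s + c) (case_nat e \<omega>)) \<partial>exp_seq"
  let ?g = "\<lambda>e. ennreal (Linv (Lam s + e) - s) + (\<integral>\<^sup>+\<omega>. \<Phi> (Linv (Lam s + e)) \<omega> \<partial>exp_seq)"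
  have h [measurable]: "?h \<in> borel_measurable borel"
  proof (rule exp_seq.borel_measurable_nn_integral)
    have "(\<lambda>x. case_nat (fst x) (snd x)) \<in> borel \<Otimes>\<^sub>M exp_seq \<rightarrow>\<^sub>M exp_seq"
      by (rule measurable_cons_exp_seq) auto
    from measurable_compose[OF this \<Psi>_sect]
    show "(\<lambda>(e, \<omega>). ennreal c + \<Psi> (s + c) (case_nat e \<omega>)) \<in> borel_measurable (borel \<Otimes>\<^sub>M exp_seq)"
      unfolding case_prod_unfold by (intro borel_measurable_add) auto
  qed
  have g [measurable]: "?g \<in> borel_measurable borel"
  proof -
    have "(\<lambda>x. \<integral>\<^sup>+\<omega>. \<Phi> x \<omega> \<partial>exp_seq) \<in> borel_measurable borel"
      using \<Phi> by (rule exp_seq.borel_measurable_nn_integral)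
    then show ?thesis by measurable
  qed
  have eq: "(\<integral>\<^sup>+\<omega>. step c \<Phi> \<Psi> s (case_nat e \<omega>) \<partial>exp_seq) = ?g e * indicator {..<L} e + ?h (e - L) * indicator {L..} e" for e
  proof (cases "e < L")
    case True
    have "(\<integral>\<^sup>+\<omega>. ennreal (Linv (Lam s + e) - s) + \<Phi> (Linv (Lam s + e)) \<omega> \<partial>exp_seq) = ?g e"
      by (subst nn_integral_add) auto
    with True show ?thesis
      by (simp add: step_def L_def[symmetric])
  next
    case False
    then show ?thesis by (simp add: step_def L_def[symmetric])
  qed
  have "(\<integral>\<^sup>+\<omega>. step c \<Phi> \<Psi> s \<omega> \<partial>exp_seq) = (\<integral>\<^sup>+e. ?g e * indicator {..<L} e + ?h (e - L) * indicator {L..} e \<partial>exp_law)"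
    by (subst nn_integral_exp_seq_cons) (simp_all add: eq)
  also have "\<dots> = (\<integral>\<^sup>+e. ?g e * indicator {..<L} e \<partial>exp_law) + (\<integral>\<^sup>+e. ?h (e - L) * indicator {L..} e \<partial>exp_law)"
    by (rule nn_integral_add) measurable
  also have "(\<integral>\<^sup>+e. ?h (e - L) * indicator {L..} e \<partial>exp_law) = ennreal (exp (- L)) * (\<integral>\<^sup>+e. ?h e \<partial>exp_law)"
    using L by (intro exp_law_memoryless) measurable
  \<comment> \<open>Residual and tail are recombined into one sequence: the splitting of the first
    coordinate is read backwards.\<close>
  also have "(\<integral>\<^sup>+e. ?h e \<partial>exp_law) = (\<integral>\<^sup>+\<omega>. ennreal c + \<Psi> (s + c) \<omega> \<partial>exp_seq)"
    using \<Psi>_sect by (subst nn_integral_exp_seq_cons) auto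
  also have "\<dots> = ennreal c + (\<integral>\<^sup>+\<omega>. \<Psi> (s + c) \<omega> \<partial>exp_seq)"
    by (subst nn_integral_add) auto
  finally show ?thesis .
qed

end

section \<open>The renewal equation for the expected duration\<close>

lemma emeasure_exp_law_lessThan:
  assumes "0 \<le> L"
  shows "emeasure exp_law {..<L} = ennreal (1 - exp (- L))"
proof -
  have "emeasure exp_law {L..} = (\<integral>\<^sup>+e. 1 * indicator {L..} e \<partial>exp_law)"
    by simp
  also have "\<dots> = ennreal (exp (- L))"
    using assms by (subst exp_law_memoryless) simp_all
  finally have "measure exp_law {L..} = exp (- L)"
    by (simp add: measure_def)
  moreover have "{..<L} = space exp_law - {L..}" by auto
  ultimately have "measure exp_law {..<L} = 1 - exp (- L)"
    using exp_law.prob_compl[of "{L..}"] by simp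
  then show ?thesis by (simp add: exp_law.emeasure_eq_measure)
qed

context hazard
begin

definition mean :: "real list \<Rightarrow> real \<Rightarrow> ennreal" where
  "mean cs s = (\<integral>\<^sup>+\<omega>. dur cs s \<omega> \<partial>exp_seq)"

text \<open>At constant rate \<open>u\<close> a task of length c takes (exp (u c) - 1) / u on
  average, which is at most c exp (u c).\<close>

definition bound :: "real list \<Rightarrow> real" where
  "bound cs = (\<Sum>c\<leftarrow>cs. c * exp (u * c))"

text \<open>The density at x of the first disruption after s.\<close>
definition hit :: "real \<Rightarrow> real \<Rightarrow> real" where
  "hit s x = lam x * exp (- (Lam x - Lam s))"

lemma hit_nonneg: "0 \<le> hit s x"
  using lam_pos[of x] by (simp add: hit_def)

lemma hit_borel [measurable]: "hit s \<in> borel_measurable borel"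
  unfolding hit_def by measurable

lemma hit_le:
  assumes "s \<le> x"
  shows "hit s x \<le> u"
proof -
  have "lam x * exp (- (Lam x - Lam s)) \<le> u * 1"
    using lam_upper[of x] u_pos assms by (intro mult_mono) auto
  then show ?thesis by (simp add: hit_def)
qed

lemma hit_has_integral:
  assumes "0 \<le> c"
  shows "(hit s has_integral (1 - exp (- (Lam (s + c) - Lam s)))) {s..s + c}"
proof -
  have "((\<lambda>x. - exp (- (Lam x - Lam s))) has_real_derivative hit s x) (at x)" for x
    unfolding hit_def by (auto intro!: derivative_eq_intros Lam_deriv)
  then have "(hit s has_integral (- exp (- (Lam (s + c) - Lam s)) - (- exp (- (Lam s - Lam s))))) {s..s + c}"
    using assms by (intro fundamental_theorem_of_calculus)
      (auto simp: has_real_derivative_iff_has_vector_derivative has_vector_derivative_at_within)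
  then show ?thesis by simp
qed

lemma mean_Nil [simp]: "mean [] s = 0"
  by (simp add: mean_def)

lemma mean_borel [measurable]: "mean cs \<in> borel_measurable borel"
  using dur_measurable[of cs] unfolding mean_def by (rule exp_seq.borel_measurable_nn_integral)

lemma bound_nonneg: "\<forall>c\<in>set cs. 0 < c \<Longrightarrow> 0 \<le> bound cs"
  by (induction cs) (auto simp: bound_def)

text \<open>The bound K of a list satisfies K(c # cs) = K(cs) + c exp(u c), which is exactly what makes it
  invariant under one renewal whose no-disruption probability is at least exp(-u c).\<close>
lemma stage_integral_le:
  assumes "\<forall>c\<in>set cs. 0 < c"
  shows "(\<integral>\<^sup>+\<omega>. stage j cs s \<omega> \<partial>exp_seq) \<le> ennreal (bound cs)"
  using assms
proof (induction j cs arbitrary: s rule: stage.induct)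
  case (3 j c cs)
  have c: "0 < c" and pos: "\<forall>c\<in>set cs. 0 < c" using 3 by auto
  define L where "L = Lam (s + c) - Lam s"
  have L: "0 \<le> L" "L \<le> u * c" using c Lam_diff_upper[of s "s + c"] by (auto simp: L_def)
  define K where "K = bound (c # cs)"
  have K: "K = c * exp (u * c) + bound cs" by (simp add: K_def bound_def)
  have K0: "0 \<le> bound cs" "0 \<le> K" using bound_nonneg[OF pos] c by (auto simp: K)
  have "(\<integral>\<^sup>+\<omega>. stage (Suc j) (c # cs) s \<omega> \<partial>exp_seq) =
    (\<integral>\<^sup>+e. (ennreal (Linv (Lam s + e) - s) + (\<integral>\<^sup>+\<omega>. stage j (c # cs) (Linv (Lam s + e)) \<omega> \<partial>exp_seq)) * indicator {..<L} e \<partial>exp_law)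
    + ennreal (exp (- L)) * (ennreal c + (\<integral>\<^sup>+\<omega>. stage (Suc j) cs (s + c) \<omega> \<partial>exp_seq))"
    using c unfolding L_def stage.simps by (intro nn_integral_step stage_measurable) auto
  also have "\<dots> \<le> (\<integral>\<^sup>+e. ennreal (c + K) * indicator {..<L} e \<partial>exp_law) + ennreal (exp (- L)) * (ennreal c + ennreal (bound cs))"
  proof (intro add_mono mult_left_mono order_refl nn_integral_mono "3.IH" pos)
    fix e
    have "Linv (Lam s + e) - s \<le> c" if "e < L"
      using that by (simp add: L_def Linv_le_iff' diff_le_eq add.commute)
    moreover have "(\<integral>\<^sup>+\<omega>. stage j (c # cs) (Linv (Lam s + e)) \<omega> \<partial>exp_seq) \<le> ennreal K"
      using 3 unfolding K_def by blast
    ultimately show "(ennreal (Linv (Lam s + e) - s) + (\<integral>\<^sup>+\<omega>. stage j (c # cs) (Linv (Lam s + e)) \<omega> \<partial>exp_seq)) * indicator {..<L} e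
       \<le> ennreal (c + K) * indicator {..<L} e"
      using c K0 by (auto simp: indicator_def intro!: add_mono ennreal_leI)
  qed simp_all
  also have "(\<integral>\<^sup>+e. ennreal (c + K) * indicator {..<L} e \<partial>exp_law) = ennreal (c + K) * ennreal (1 - exp (- L))"
    using L by (subst nn_integral_cmult_indicator) (auto simp: emeasure_exp_law_lessThan)
  also have "ennreal (c + K) * ennreal (1 - exp (- L)) + ennreal (exp (- L)) * (ennreal c + ennreal (bound cs))
    = ennreal ((c + K) * (1 - exp (- L)) + exp (- L) * (c + bound cs))"
    using c K0 L by (simp add: ennreal_mult ennreal_plus)
  also have "\<dots> \<le> ennreal K"
  proof (rule ennreal_leI)
    \<comment> \<open>By the choice of \<open>K\<close> the claim reduces to c <= c exp (u c - L),
      which holds because L <= u c.\<close>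
    have "1 = exp (- L) * exp L" by (simp flip: exp_add)
    also have "\<dots> \<le> exp (- L) * exp (u * c)" using L by simp
    finally have "c * 1 \<le> c * (exp (- L) * exp (u * c))" using c by (intro mult_left_mono) auto
    then show "(c + K) * (1 - exp (- L)) + exp (- L) * (c + bound cs) \<le> K"
      unfolding K by (simp add: algebra_simps)
  qed
  finally show ?case by (simp add: K_def)
qed auto

text \<open>Monotone convergence carries the bound from the stages to the limit. This makes the
  expectation finite and the passage to real values legitimate.\<close>

lemma mean_le: 
  assumes "\<forall>c\<in>set cs. 0 < c"
  shows "mean cs s \<le> ennreal (bound cs)"
proof -
  have "stage j cs s \<in> borel_measurable exp_seq" for j
    using stage_measurable by (rule measurable_uncurried_comp) auto
  moreover have "incseq (\<lambda>j. stage j cs s)"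
    using incseq_stage by (auto simp: incseq_def le_fun_def)
  ultimately have "mean cs s = (SUP j. \<integral>\<^sup>+\<omega>. stage j cs s \<omega> \<partial>exp_seq)"
    unfolding mean_def dur_def by (intro nn_integral_monotone_convergence_SUP)
  then show ?thesis using stage_integral_le[OF assms] by (simp add: SUP_le_iff)
qed

text \<open>Change of variables e = Lam x - Lam s, from accumulated hazard to time: exp (- e) de
  becomes hit s x dx.\<close>

lemma exp_law_substitution:
  assumes [measurable]: "G \<in> borel_measurable borel" and c: "0 < c"
  shows "(\<integral>\<^sup>+e. G (Linv (Lam s + e)) * indicator {..<Lam (s + c) - Lam s} e \<partial>exp_law)
    = (\<integral>\<^sup>+x. G x * ennreal (hit s x) * indicator {s..s + c} x \<partial>lborel)"
proof -
  let ?L = "Lam (s + c) - Lam s"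
  let ?f = "\<lambda>e. G (Linv (Lam s + e)) * ennreal (exp (- e))"
  have f[measurable]: "?f \<in> borel_measurable borel" by measurable
  have "(\<integral>\<^sup>+e. G (Linv (Lam s + e)) * indicator {..<?L} e \<partial>exp_law)
    = (\<integral>\<^sup>+e. G (Linv (Lam s + e)) * indicator {..<?L} e * ennreal (exp (- e)) * indicator {0..} e \<partial>lborel)"
    by (rule nn_integral_exp_law) measurable
  \<comment> \<open>The right endpoint is a null set; the left endpoint 0 is written as
    \<open>Lam s - Lam s\<close> to match the substitution rule.\<close>
  also have "\<dots> = (\<integral>\<^sup>+e. ?f e * indicator {Lam s - Lam s..?L} e \<partial>lborel)"
    using AE_lborel_singleton[of ?L]
    by (intro nn_integral_cong_AE, elim eventually_mono) (auto simp: indicator_def)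
  also have "\<dots> = (\<integral>\<^sup>+x. ?f (Lam x - Lam s) * ennreal (lam x) * indicator {s..s + c} x \<partial>lborel)"
  proof -
    have deriv: "((\<lambda>x. Lam x - Lam s) has_real_derivative lam x) (at x)" for x
      by (auto intro!: derivative_eq_intros Lam_deriv)
    have cont: "continuous_on {s..s + c} lam" using lam_cont by (rule continuous_on_subset) simp
    show ?thesis
      by (rule nn_integral_substitution_aux[OF f _ deriv cont less_imp_le[OF lam_pos]])
        (use c in simp_all)
  qed
  also have "\<dots> = (\<integral>\<^sup>+x. G x * ennreal (hit s x) * indicator {s..s + c} x \<partial>lborel)"
    using lam_pos by (intro nn_integral_cong)
      (simp add: hit_def ennreal_mult less_imp_le mult_ac)
  finally show ?thesis .
qed

lemma mean_Cons:
  assumes "0 < c"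
  shows "mean (c # cs) s =
    (\<integral>\<^sup>+x. (ennreal (x - s) + mean (c # cs) x) * ennreal (hit s x) * indicator {s..s + c} x \<partial>lborel)
    + ennreal (exp (- (Lam (s + c) - Lam s))) * (ennreal c + mean cs (s + c))"
proof -
  have "mean (c # cs) s = (\<integral>\<^sup>+\<omega>. step c (dur (c # cs)) (dur cs) s \<omega> \<partial>exp_seq)"
    by (simp add: mean_def dur_Cons[of c cs s])
  also have "\<dots> = (\<integral>\<^sup>+e. (ennreal (Linv (Lam s + e) - s) + mean (c # cs) (Linv (Lam s + e)))
        * indicator {..<Lam (s + c) - Lam s} e \<partial>exp_law)
      + ennreal (exp (- (Lam (s + c) - Lam s))) * (ennreal c + mean cs (s + c))"
    using assms unfolding mean_def by (intro nn_integral_step dur_measurable) auto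
  also have "(\<integral>\<^sup>+e. (ennreal (Linv (Lam s + e) - s) + mean (c # cs) (Linv (Lam s + e)))
        * indicator {..<Lam (s + c) - Lam s} e \<partial>exp_law)
    = (\<integral>\<^sup>+x. (ennreal (x - s) + mean (c # cs) x) * ennreal (hit s x) * indicator {s..s + c} x \<partial>lborel)"
    using assms by (intro exp_law_substitution) measurable
  finally show ?thesis .
qed

section \<open>Real-valued expectation and its integral equation\<close>

definition rmean :: "real list \<Rightarrow> real \<Rightarrow> real" where
  "rmean cs s = enn2real (mean cs s)"

lemma rmean_Nil [simp]: "rmean [] s = 0"
  by (simp add: rmean_def)

lemma rmean_borel [measurable]: "rmean cs \<in> borel_measurable borel"
  unfolding rmean_def by measurable

lemma rmean_nonneg: "0 \<le> rmean cs s"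
  by (simp add: rmean_def)

lemma mean_eq_rmean: "\<forall>c\<in>set cs. 0 < c \<Longrightarrow> mean cs s = ennreal (rmean cs s)"
  using mean_le[of cs s] ennreal_less_top[of "bound cs"] unfolding rmean_def
  by (metis ennreal_enn2real le_less_trans)

lemma rmean_le: "\<forall>c\<in>set cs. 0 < c \<Longrightarrow> rmean cs s \<le> bound cs"
  using mean_le[of cs s] bound_nonneg[of cs] by (simp add: mean_eq_rmean)

lemma rmean_Cons_has_integral:
  assumes "0 < c" "\<forall>c\<in>set cs. 0 < c"
  shows "((\<lambda>x. hit s x * (x - s + rmean (c # cs) x)) has_integral
    (rmean (c # cs) s - exp (- (Lam (s + c) - Lam s)) * (c + rmean cs (s + c)))) {s..s + c}"
proof -
  have pos: "\<forall>x\<in>set (c # cs). 0 < x" using assms by simp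
  let ?g = "\<lambda>x. hit s x * (x - s + rmean (c # cs) x)"
  let ?E = "exp (- (Lam (s + c) - Lam s))"
  \<comment> \<open>Boundedness gives integrability, so the nonnegative integral becomes a real one,
    to which signed estimates apply.\<close>
  have bnd: "norm (?g x) \<le> u * (c + bound (c # cs))" if "x \<in> {s..s + c}" for x
    using that hit_le[of s x] hit_nonneg[of s x] rmean_nonneg[of "c # cs" x] rmean_le[OF pos, of x] u_pos
    by (auto simp: abs_mult intro!: mult_mono)
  have int: "integrable lborel (\<lambda>x. indicator {s..s + c} x *\<^sub>R ?g x)"
    by (rule integrableI_bounded_set_indicator) (use bnd assms(1) in auto)
  have nonneg: "0 \<le> indicator {s..s + c} x *\<^sub>R ?g x" for x
    using hit_nonneg[of s x] rmean_nonneg[of "c # cs" x] by (auto simp: indicator_def)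
  have "(\<integral>\<^sup>+x. (ennreal (x - s) + mean (c # cs) x) * ennreal (hit s x) * indicator {s..s + c} x \<partial>lborel)
     = (\<integral>\<^sup>+x. ennreal (indicator {s..s + c} x *\<^sub>R ?g x) \<partial>lborel)"
    using rmean_nonneg[of "c # cs"] hit_nonneg[of s]
    by (intro nn_integral_cong)
      (auto simp: mean_eq_rmean[OF pos] indicator_def mult.commute simp flip: ennreal_plus ennreal_mult)
  also have "\<dots> = ennreal (LINT x|lborel. indicator {s..s + c} x *\<^sub>R ?g x)"
    using int nonneg by (intro nn_integral_eq_integral) auto
  finally have "ennreal (rmean (c # cs) s) = ennreal (LINT x|lborel. indicator {s..s + c} x *\<^sub>R ?g x)
      + ennreal (?E * (c + rmean cs (s + c)))"
    using mean_Cons[OF assms(1), of cs s] assms rmean_nonneg[of cs "s + c"]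
    by (simp add: mean_eq_rmean ennreal_plus ennreal_mult)
  also have "\<dots> = ennreal ((LINT x|lborel. indicator {s..s + c} x *\<^sub>R ?g x) + ?E * (c + rmean cs (s + c)))"
    using assms rmean_nonneg[of cs "s + c"] nonneg by (intro ennreal_plus[symmetric]) auto
  finally have "rmean (c # cs) s = (LINT x|lborel. indicator {s..s + c} x *\<^sub>R ?g x) + ?E * (c + rmean cs (s + c))"
    using assms rmean_nonneg[of cs "s + c"] rmean_nonneg[of "c # cs" s] nonneg
    by (subst (asm) ennreal_inj) auto
  moreover have "(?g has_integral (LINT x:{s..s + c}|lborel. ?g x)) {s..s + c}"
    using int set_borel_integral_eq_integral[of "{s..s + c}" ?g]
    by (auto simp: set_integrable_def has_integral_integral)
  ultimately show ?thesis by (simp add: set_lebesgue_integral_def)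
qed

text \<open>Since \<open>hit s\<close> has mass 1 - exp (- (Lam (s + c) - Lam s)) on the window,
  subtracting the constant c + rmean cs (s + c) absorbs the no-disruption term. What remains is an
  equation for the excess over the undisturbed run alone.\<close>

lemma rmean_Cons_diff_has_integral:
  assumes "0 < c" "\<forall>c\<in>set cs. 0 < c"
  shows "((\<lambda>x. hit s x * (x - s + (rmean (c # cs) x - c - rmean cs (s + c)))) has_integral
    (rmean (c # cs) s - c - rmean cs (s + c))) {s..s + c}"
proof -
  have "((\<lambda>x. hit s x * (x - s + rmean (c # cs) x) - hit s x * (c + rmean cs (s + c))) has_integral
    (rmean (c # cs) s - exp (- (Lam (s + c) - Lam s)) * (c + rmean cs (s + c))
     - (1 - exp (- (Lam (s + c) - Lam s))) * (c + rmean cs (s + c)))) {s..s + c}"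
    using assms by (intro has_integral_diff rmean_Cons_has_integral has_integral_mult_left hit_has_integral) auto
  then show ?thesis by (simp add: algebra_simps)
qed

text \<open>Only the outcome without any disruption is counted. Together with
  \<open>bound_le\<close> this encloses \<open>rmean cs s\<close> uniformly in
  \<open>s\<close>.\<close>

lemma rmean_ge:
  assumes "\<forall>c\<in>set cs. 0 < c"
  shows "exp (- u * sum_list cs) * sum_list cs \<le> rmean cs s"
  using assms
proof (induction cs arbitrary: s)
  case (Cons c cs)
  have c: "0 < c" and pos: "\<forall>c\<in>set cs. 0 < c" using Cons.prems by auto
  have S: "0 \<le> sum_list cs" using pos by (intro sum_list_nonneg) (auto intro: less_imp_le)
  have L: "Lam (s + c) - Lam s \<le> u * c" using Lam_diff_upper[of s "s + c"] c by simp
  have "exp (- u * sum_list (c # cs)) * sum_list (c # cs) = exp (- u * c) * (exp (- u * sum_list cs) * c + exp (- u * sum_list cs) * sum_list cs)"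
  proof -
    have "exp (- u * sum_list (c # cs)) = exp (- u * c) * exp (- u * sum_list cs)"
      unfolding exp_add[symmetric] by (simp add: algebra_simps)
    then show ?thesis by (simp add: distrib_left mult.assoc)
  qed
  also have "\<dots> \<le> exp (- u * c) * (1 * c + rmean cs (s + c))"
    using Cons.IH[OF pos, of "s + c"] c u_pos S
    by (intro mult_left_mono add_mono mult_right_mono) (auto intro!: mult_nonneg_nonneg)
  also have "\<dots> \<le> exp (- (Lam (s + c) - Lam s)) * (c + rmean cs (s + c))"
    using L rmean_nonneg[of cs "s + c"] c by (intro mult_mono) auto
  also have "\<dots> \<le> rmean (c # cs) s"
    using has_integral_nonneg[OF rmean_Cons_has_integral[OF c pos, of s]]
      hit_nonneg[of s] rmean_nonneg[of "c # cs"] by (auto intro!: mult_nonneg_nonneg)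
  finally show ?case .
qed simp

lemma bound_le: 
  assumes "\<forall>c\<in>set cs. 0 < c"
  shows "bound cs \<le> exp (u * sum_list cs) * sum_list cs"
  using assms
proof (induction cs)
  case (Cons c cs)
  have c: "0 < c" and pos: "\<forall>c\<in>set cs. 0 < c" using Cons.prems by auto
  have S: "0 \<le> sum_list cs" using pos by (intro sum_list_nonneg) (auto intro: less_imp_le)
  have "bound (c # cs) \<le> c * exp (u * c) + exp (u * sum_list cs) * sum_list cs"
    using Cons.IH[OF pos] by (simp add: bound_def)
  also have "\<dots> \<le> c * exp (u * sum_list (c # cs)) + exp (u * sum_list (c # cs)) * sum_list cs"
    using c S u_pos by (intro add_mono mult_left_mono mult_right_mono) (auto intro!: mult_left_mono)
  finally show ?case by (simp add: algebra_simps)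
qed (simp add: bound_def)

text \<open>On a good path the partial sums of the increments are nonnegative, so the description in
  \<open>nhpp_point\<close> has a unique solution, given by \<open>Linv\<close>. For this the two
  cumulative rates have to agree at nonnegative times only.\<close>

lemma exp_makespan_eq_mean:
  assumes "\<And>t. 0 \<le> t \<Longrightarrow> cum_int r t = Lam t" "\<forall>c\<in>set cs. 0 < c"
  shows "exp_makespan r cs 0 = ennreal (rmean cs 0)"
proof -
  have nhpp: "nhpp_point r \<omega> = points 0 \<omega>" if "good \<omega>" for \<omega>
  proof
    fix k
    let ?S = "\<Sum>j\<le>k. \<omega> j"
    have "0 \<le> ?S" using good_nonneg[OF that] by (intro sum_nonneg) auto
    then have ge: "0 \<le> Linv ?S" by (simp add: le_Linv_iff Lam_0)
    have "(THE s. 0 \<le> s \<and> cum_int r s = ?S) = Linv ?S"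
    proof (rule the_equality)
      show "0 \<le> Linv ?S \<and> cum_int r (Linv ?S) = ?S" using ge assms(1) by simp
      fix t assume "0 \<le> t \<and> cum_int r t = ?S"
      then have "Lam t = ?S" using assms(1)[of t] by metis
      then show "t = Linv ?S" using Linv_Lam[of t] by simp
    qed
    then show "nhpp_point r \<omega> k = points 0 \<omega> k"
      by (simp add: nhpp_point_def points_def Lam_0)
  qed
  have "AE \<omega> in exp_seq. ennreal (finish_time (nhpp_point r \<omega>) cs 0 - 0) = dur cs 0 \<omega>"
    using AE_good by eventually_elim (simp add: nhpp dur_eq_finish_time[OF _ assms(2)])
  then have "exp_makespan r cs 0 = mean cs 0"
    unfolding exp_makespan_def mean_def by (rule nn_integral_cong_AE)
  then show ?thesis by (simp add: mean_eq_rmean[OF assms(2)])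
qed

end

section \<open>Expansion for short tasks\<close>

lemma polynomial_has_integral:
  fixes a b d s c :: real
  assumes "0 \<le> c"
  shows "((\<lambda>x. a * (x - s) + b * (x - s)\<^sup>2 + d) has_integral (a * c\<^sup>2 / 2 + b * c ^ 3 / 3 + d * c)) {s..s + c}"
proof -
  let ?F = "\<lambda>x. a * (x - s)\<^sup>2 / 2 + b * (x - s) ^ 3 / 3 + d * (x - s)"
  have "(?F has_real_derivative a * (x - s) + b * (x - s)\<^sup>2 + d) (at x within {s..s + c})" for x
    by (auto intro!: derivative_eq_intros simp: field_simps power2_eq_square)
  then have "((\<lambda>x. a * (x - s) + b * (x - s)\<^sup>2 + d) has_integral (?F (s + c) - ?F s)) {s..s + c}"
    using assms by (intro fundamental_theorem_of_calculus)
      (auto simp: has_real_derivative_iff_has_vector_derivative)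
  then show ?thesis by simp
qed

lemma exp_minus_quadratic_bound:
  fixes x :: real
  assumes "0 \<le> x"
  shows "\<bar>exp (- x) - 1 + x\<bar> \<le> x\<^sup>2"
proof -
  have "1 + x \<le> exp x" "1 + - x \<le> exp (- x)" by (rule exp_ge_add_one_self)+
  \<comment> \<open>The product is 1 + x^3, so the quadratic dominates 1 / (1 + x) and hence exp (-
    x).\<close>
  moreover have "1 \<le> (1 - x + x\<^sup>2) * (1 + x)"
    using assms by (simp add: algebra_simps power2_eq_square)
  moreover have "(1 - x + x\<^sup>2) * (1 + x) \<le> (1 - x + x\<^sup>2) * exp x"
  proof (rule mult_left_mono[OF \<open>1 + x \<le> exp x\<close>])
    have "0 \<le> (x - 1)\<^sup>2 + x" using assms by simp
    then show "0 \<le> 1 - x + x\<^sup>2" by (simp add: power2_eq_square algebra_simps)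
  qed
  ultimately have "exp (- x) \<le> 1 - x + x\<^sup>2"
    by (simp add: exp_minus field_simps)
  with \<open>1 + - x \<le> exp (- x)\<close> show ?thesis by simp
qed

lemma eventually_mult_le:
  fixes A \<eta> :: real
  assumes "0 < \<eta>"
  shows "\<forall>\<^sub>F \<epsilon> in at_right 0. A * \<epsilon> \<le> \<eta>"
proof -
  have "((\<lambda>\<epsilon>. A * \<epsilon>) \<longlongrightarrow> 0) (at_right 0)" by (auto intro!: tendsto_eq_intros)
  then have "\<forall>\<^sub>F \<epsilon> in at_right 0. A * \<epsilon> < \<eta>" using assms by (rule order_tendstoD(2))
  then show ?thesis by eventually_elim simp
qed

lemma eventually_pos_at_right: "\<forall>\<^sub>F \<epsilon> in at_right (0::real). 0 < \<epsilon>"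
  by (simp add: eventually_at_right_less)

context hazard
begin

text \<open>The source of the gain in order: an error \<open>\<delta>\<close> in the integrand costs
  only \<open>\<delta> * c\<close> after integration over the window. In the model polynomial,
  \<open>d\<close> stands for the part of the remainder that is constant on the window.\<close>

lemma rmean_Cons_estimate:
  assumes "0 < c" "\<forall>c\<in>set cs. 0 < c"
    and "\<And>x. x \<in> {s..s + c} \<Longrightarrow> \<bar>hit s x * (x - s + (rmean (c # cs) x - c - rmean cs (s + c)))
      - (a * (x - s) + b * (x - s)\<^sup>2 + d)\<bar> \<le> \<delta>"
  shows "\<bar>rmean (c # cs) s - c - rmean cs (s + c) - (a * c\<^sup>2 / 2 + b * c ^ 3 / 3 + d * c)\<bar> \<le> \<delta> * c"
proof -
  have "0 \<le> \<delta>" using assms(1) assms(3)[of s] by (auto intro: order_trans[OF abs_ge_zero])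
  have "norm (rmean (c # cs) s - c - rmean cs (s + c) - (a * c\<^sup>2 / 2 + b * c ^ 3 / 3 + d * c))
      \<le> \<delta> * measure lborel {s..s + c}"
    by (rule has_integral_bound_real[OF \<open>0 \<le> \<delta>\<close> finite.emptyI has_integral_diff[OF
          rmean_Cons_diff_has_integral[OF assms(1,2)] polynomial_has_integral[OF less_imp_le[OF assms(1)]]]])
      (use assms(3) in auto)
  then show ?thesis using assms(1) by simp
qed

text \<open>Squeezed between \<open>rmean_ge\<close> and \<open>bound_le\<close>, which are both the
  total length times a factor tending to 1, whatever the start time.\<close>

lemma rmean_first_order:
  assumes "\<forall>b\<in>set bs. 0 < b" "0 < \<eta>"
  shows "\<forall>\<^sub>F \<epsilon> in at_right 0. \<forall>s. \<bar>rmean (map ((*) \<epsilon>) bs) s - sum_list (map ((*) \<epsilon>) bs)\<bar> \<le> \<eta> * \<epsilon>"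
proof -
  define B where "B = sum_list bs"
  have sum: "sum_list (map ((*) \<epsilon>) bs) = \<epsilon> * B" for \<epsilon>
    unfolding B_def by (induction bs) (auto simp: algebra_simps)
  have "((\<lambda>\<epsilon>. B * (exp (u * (\<epsilon> * B)) - 1)) \<longlongrightarrow> 0) (at_right 0)"
    "((\<lambda>\<epsilon>. B * (1 - exp (- u * (\<epsilon> * B)))) \<longlongrightarrow> 0) (at_right 0)"
    by (auto intro!: tendsto_eq_intros)
  from this[THEN order_tendstoD(2), OF assms(2)]
  show ?thesis using eventually_pos_at_right
  proof eventually_elim
    case (elim \<epsilon>)
    show ?case
    proof
      fix s
      let ?cs = "map ((*) \<epsilon>) bs"
      have pos: "\<forall>c\<in>set ?cs. 0 < c" using assms(1) elim by auto
      have "rmean ?cs s \<le> exp (u * (\<epsilon> * B)) * (\<epsilon> * B)"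
        using order_trans[OF rmean_le[OF pos] bound_le[OF pos]] by (simp add: sum)
      moreover have "exp (- u * (\<epsilon> * B)) * (\<epsilon> * B) \<le> rmean ?cs s"
        using rmean_ge[OF pos] by (simp add: sum)
      moreover have "\<epsilon> * (B * (exp (u * (\<epsilon> * B)) - 1)) \<le> \<epsilon> * \<eta>"
        "\<epsilon> * (B * (1 - exp (- u * (\<epsilon> * B)))) \<le> \<epsilon> * \<eta>"
        using elim by (auto intro!: mult_left_mono)
      ultimately show "\<bar>rmean ?cs s - sum_list ?cs\<bar> \<le> \<eta> * \<epsilon>"
        unfolding sum abs_le_iff by (simp add: algebra_simps)
    qed
  qed
qed

end

text \<open>The derivative is one-sided because the rate is extended by a constant to the left of 0
  (\<open>intensity_hazard\<close>), which may create a kink there.\<close>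

locale hazard_deriv = hazard +
  fixes l1 :: real
  assumes lam_deriv_0: "(lam has_real_derivative l1) (at 0 within {0..})"
begin

lemma lam_expansion:
  assumes "0 \<le> K" "0 < \<eta>"
  shows "\<forall>\<^sub>F \<epsilon> in at_right 0. \<forall>x\<in>{0..K * \<epsilon>}. \<bar>lam x - lam 0 - l1 * x\<bar> \<le> \<eta> * \<epsilon>"
proof -
  \<comment> \<open>\<open>K + 1\<close> instead of \<open>K\<close> admits
    \<open>K = 0\<close>.\<close>
  define e where "e = \<eta> / (K + 1)"
  have e: "0 < e" "e * K \<le> \<eta>" using assms by (auto simp: e_def field_simps)
  from lam_deriv_0[unfolded has_field_derivative_def has_derivative_within_alt] e(1)
  obtain d where d: "0 < d" "\<And>x. 0 \<le> x \<Longrightarrow> \<bar>x\<bar> < d \<Longrightarrow> \<bar>lam x - lam 0 - l1 * x\<bar> \<le> e * \<bar>x\<bar>"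
    by (auto simp: mult.commute)
  have "\<forall>\<^sub>F \<epsilon> in at_right 0. K * \<epsilon> \<le> d / 2" using d by (intro eventually_mult_le) auto
  then show ?thesis using eventually_pos_at_right
  proof eventually_elim
    case (elim \<epsilon>)
    show ?case
    proof
      fix x assume x: "x \<in> {0..K * \<epsilon>}"
      then have "\<bar>lam x - lam 0 - l1 * x\<bar> \<le> e * x" using d elim by auto
      also have "\<dots> \<le> e * (K * \<epsilon>)" using x e by (intro mult_left_mono) auto
      also have "\<dots> \<le> \<eta> * \<epsilon>" using e elim by (simp flip: mult.assoc)
      finally show "\<bar>lam x - lam 0 - l1 * x\<bar> \<le> \<eta> * \<epsilon>" .
    qed
  qed
qed

lemma hit_expansion:
  assumes "0 \<le> K" "0 < \<eta>"
  shows "\<forall>\<^sub>F \<epsilon> in at_right 0. \<forall>s x. 0 \<le> s \<and> s \<le> x \<and> x \<le> K * \<epsilon> \<longrightarrow>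
    \<bar>hit s x - (lam 0 + l1 * x - (lam 0)\<^sup>2 * (x - s))\<bar> \<le> \<eta> * \<epsilon>"
proof -
  define C where "C = 1 + \<bar>l1\<bar> * K"
  \<comment> \<open>\<open>A\<close> collects the coefficients of \<epsilon>^2 in the bounds
    \<open>t2\<close>, \<open>t3\<close> and \<open>t4\<close>.\<close>
  define A where "A = u ^ 3 * K\<^sup>2 + (u + lam 0) * C * K"
  have C: "0 \<le> C" using assms by (simp add: C_def)
  have "\<forall>\<^sub>F \<epsilon> in at_right 0. \<forall>x\<in>{0..K * \<epsilon>}. \<bar>lam x - lam 0 - l1 * x\<bar> \<le> 1 * \<epsilon>"
    using assms by (intro lam_expansion) auto
  moreover have "\<forall>\<^sub>F \<epsilon> in at_right 0. \<forall>x\<in>{0..K * \<epsilon>}. \<bar>lam x - lam 0 - l1 * x\<bar> \<le> \<eta> / 2 * \<epsilon>"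
    using assms by (intro lam_expansion) auto
  moreover have "\<forall>\<^sub>F \<epsilon> in at_right 0. A * \<epsilon> \<le> \<eta> / 2"
    using assms by (intro eventually_mult_le) auto
  ultimately show ?thesis using eventually_pos_at_right
  proof eventually_elim
    case (elim \<epsilon>)
    show ?case
    proof (intro allI impI, elim conjE)
      fix s x assume sx: "0 \<le> s" "s \<le> x" "x \<le> K * \<epsilon>"
      define y where "y = x - s"
      have y: "0 \<le> y" "y \<le> K * \<epsilon>" using sx by (auto simp: y_def)
      have C_bound: "\<bar>lam z - lam 0\<bar> \<le> C * \<epsilon>" if z: "z \<in> {0..K * \<epsilon>}" for z
      proof -
        have "\<bar>lam z - lam 0\<bar> \<le> \<bar>lam z - lam 0 - l1 * z\<bar> + \<bar>l1\<bar> * z"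
        proof -
          have "\<bar>l1\<bar> * z = \<bar>l1 * z\<bar>" using z by (simp add: abs_mult)
          then show ?thesis by linarith
        qed
        also have "\<dots> \<le> 1 * \<epsilon> + \<bar>l1\<bar> * (K * \<epsilon>)"
          using z elim by (intro add_mono mult_left_mono) auto
        finally show ?thesis by (simp add: C_def algebra_simps)
      qed
      obtain z where z: "s \<le> z" "z \<le> x" "Lam x - Lam s = lam z * y"
        using Lam_diff[OF sx(2)] unfolding y_def by metis
      define \<theta> where "\<theta> = lam z * y"
      have \<theta>: "0 \<le> \<theta>" "\<theta> \<le> u * (K * \<epsilon>)"
        using y lam_pos[of z] lam_upper[of z] u_pos by (auto simp: \<theta>_def less_imp_le intro!: mult_mono)
      have t1: "\<bar>lam x - lam 0 - l1 * x\<bar> \<le> \<eta> / 2 * \<epsilon>" using elim sx by auto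
      have t2: "\<bar>lam x * (exp (- \<theta>) - 1 + \<theta>)\<bar> \<le> u * (u * (K * \<epsilon>))\<^sup>2"
        unfolding abs_mult using lam_pos[of x] lam_upper[of x] u_pos \<theta> exp_minus_quadratic_bound[of \<theta>]
        by (intro mult_mono order_trans[OF exp_minus_quadratic_bound] power_mono) auto
      have t3: "\<bar>lam x * ((lam z - lam 0) * y)\<bar> \<le> u * (C * \<epsilon> * (K * \<epsilon>))"
        unfolding abs_mult using lam_pos[of x] lam_upper[of x] u_pos y z sx C elim
        by (intro mult_mono C_bound) auto
      have t4: "\<bar>(lam x - lam 0) * (lam 0 * y)\<bar> \<le> C * \<epsilon> * (lam 0 * (K * \<epsilon>))"
        unfolding abs_mult using lam_pos[of 0] y sx C elim
        by (intro mult_mono C_bound) auto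
      \<comment> \<open>The first term is the linearization error of \<open>lam\<close>. The others
        come from replacing exp (- \<theta>) by 1 - \<theta>, then lam z by lam 0 inside \<theta>,
        then the factor lam x in front of the linear term by lam 0.\<close>
      have "hit s x - (lam 0 + l1 * x - (lam 0)\<^sup>2 * (x - s))
        = (lam x - lam 0 - l1 * x) + lam x * (exp (- \<theta>) - 1 + \<theta>) - lam x * ((lam z - lam 0) * y)
          - (lam x - lam 0) * (lam 0 * y)"
        unfolding hit_def z(3) \<theta>_def[symmetric] y_def[symmetric]
        by (simp add: \<theta>_def algebra_simps power2_eq_square)
      then have "\<bar>hit s x - (lam 0 + l1 * x - (lam 0)\<^sup>2 * (x - s))\<bar>
        \<le> \<eta> / 2 * \<epsilon> + u * (u * (K * \<epsilon>))\<^sup>2 + u * (C * \<epsilon> * (K * \<epsilon>)) + C * \<epsilon> * (lam 0 * (K * \<epsilon>))"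
        using t1 t2 t3 t4 by linarith
      also have "\<dots> = \<eta> / 2 * \<epsilon> + \<epsilon> * (A * \<epsilon>)"
        by (simp add: A_def algebra_simps power2_eq_square power3_eq_cube)
      also have "\<dots> \<le> \<eta> / 2 * \<epsilon> + \<epsilon> * (\<eta> / 2)"
        using elim by (intro add_left_mono mult_left_mono) auto
      finally show "\<bar>hit s x - (lam 0 + l1 * x - (lam 0)\<^sup>2 * (x - s))\<bar> \<le> \<eta> * \<epsilon>" by (simp add: mult.commute)
    qed
  qed
qed

lemma hit_lipschitz:
  assumes "0 \<le> K"
  obtains C where "0 \<le> C" "\<forall>\<^sub>F \<epsilon> in at_right 0. \<forall>s x. 0 \<le> s \<and> s \<le> x \<and> x \<le> K * \<epsilon> \<longrightarrow>
    \<bar>hit s x - lam 0\<bar> \<le> C * \<epsilon>"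
proof
  define C where "C = 1 + \<bar>l1\<bar> * K + (lam 0)\<^sup>2 * K"
  show "0 \<le> C" using assms by (simp add: C_def)
  have "\<forall>\<^sub>F \<epsilon> in at_right 0. \<forall>s x. 0 \<le> s \<and> s \<le> x \<and> x \<le> K * \<epsilon> \<longrightarrow>
    \<bar>hit s x - (lam 0 + l1 * x - (lam 0)\<^sup>2 * (x - s))\<bar> \<le> 1 * \<epsilon>"
    using assms by (intro hit_expansion) auto
  then show "\<forall>\<^sub>F \<epsilon> in at_right 0. \<forall>s x. 0 \<le> s \<and> s \<le> x \<and> x \<le> K * \<epsilon> \<longrightarrow> \<bar>hit s x - lam 0\<bar> \<le> C * \<epsilon>"
  proof eventually_elim
    case (elim \<epsilon>)
    show ?case
    proof (intro allI impI)
      fix s x assume sx: "0 \<le> s \<and> s \<le> x \<and> x \<le> K * \<epsilon>"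
      have "\<bar>l1 * x\<bar> \<le> \<bar>l1\<bar> * (K * \<epsilon>)" unfolding abs_mult using sx by (intro mult_left_mono) auto
      moreover have "\<bar>(lam 0)\<^sup>2 * (x - s)\<bar> \<le> (lam 0)\<^sup>2 * (K * \<epsilon>)"
        unfolding abs_mult using sx by (auto intro!: mult_left_mono)
      moreover have "\<bar>hit s x - (lam 0 + l1 * x - (lam 0)\<^sup>2 * (x - s))\<bar> \<le> 1 * \<epsilon>" using elim sx by blast
      ultimately have "\<bar>hit s x - lam 0\<bar> \<le> 1 * \<epsilon> + \<bar>l1\<bar> * (K * \<epsilon>) + (lam 0)\<^sup>2 * (K * \<epsilon>)" by linarith
      then show "\<bar>hit s x - lam 0\<bar> \<le> C * \<epsilon>" by (simp add: C_def algebra_simps)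
    qed
  qed
qed

text \<open>First pass: \<open>hit\<close> is taken as \<open>lam 0\<close>, and the remainder
  \<open>d x\<close> is o(\<epsilon>) because the total lengths cancel in it. Integrating lam 0 (x -
  s) over the window gives lam 0 c^2 / 2, independently of the position in the list.\<close>

lemma rmean_second_order:
  assumes "\<forall>b\<in>set bs. 0 < b" "0 \<le> K" "0 < \<eta>"
  shows "\<forall>\<^sub>F \<epsilon> in at_right 0. \<forall>s\<in>{0..K * \<epsilon>}.
    \<bar>rmean (map ((*) \<epsilon>) bs) s - (\<Sum>c\<leftarrow>map ((*) \<epsilon>) bs. c) - lam 0 / 2 * (\<Sum>c\<leftarrow>map ((*) \<epsilon>) bs. c\<^sup>2)\<bar> \<le> \<eta> * \<epsilon>\<^sup>2"
  using assms
proof (induction bs arbitrary: K \<eta>)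
  case Nil
  show ?case by (rule always_eventually) (use Nil in auto)
next
  case (Cons b bs)
  have b: "0 < b" and pos: "\<forall>b\<in>set bs. 0 < b" using Cons.prems by auto
  \<comment> \<open>Chosen so that the term with \<open>u\<close> becomes \<eta> \<epsilon>^2 / 4;
    the term with \<open>C\<close> gets another quarter and the rest of the list one half.\<close>
  define \<eta>' where "\<eta>' = \<eta> / (8 * u * b)"
  have \<eta>': "0 < \<eta>'" using Cons.prems b u_pos by (simp add: \<eta>'_def)
  \<comment> \<open>The rest of the list starts at \<open>s + c\<close>, which is at most (K + b)
    \<epsilon>.\<close>
  have Kb: "0 \<le> K + b" using Cons.prems b by simp
  obtain C where C: "0 \<le> C" and lip: "\<forall>\<^sub>F \<epsilon> in at_right 0. \<forall>s x. 0 \<le> s \<and> s \<le> x \<and> x \<le> (K + b) * \<epsilon> \<longrightarrow>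
    \<bar>hit s x - lam 0\<bar> \<le> C * \<epsilon>" using Kb by (rule hit_lipschitz)
  note Cons.IH[OF pos Kb half_gt_zero[OF Cons.prems(3)]]
  moreover note rmean_first_order[OF Cons.prems(1) \<eta>'] rmean_first_order[OF pos \<eta>'] lip
  moreover have "\<forall>\<^sub>F \<epsilon> in at_right 0. C * b\<^sup>2 * \<epsilon> \<le> \<eta> / 4"
    using Cons.prems by (intro eventually_mult_le) auto
  ultimately show ?case using eventually_pos_at_right
  proof eventually_elim
    case (elim \<epsilon>)
    note E = elim
    define c cs where "c = \<epsilon> * b" and "cs = map ((*) \<epsilon>) bs"
    have c: "0 < c" and cpos: "\<forall>c\<in>set cs. 0 < c" using b pos E by (auto simp: c_def cs_def)
    have cs: "map ((*) \<epsilon>) (b # bs) = c # cs" by (simp add: c_def cs_def)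
    show ?case unfolding cs
    proof
      fix s assume s: "s \<in> {0..K * \<epsilon>}"
      have sc: "s + c \<in> {0..(K + b) * \<epsilon>}" using s c by (auto simp: c_def algebra_simps)
      define d where "d x = rmean (c # cs) x - c - rmean cs (s + c)" for x
      have "\<bar>hit s x * (x - s + d x) - (lam 0 * (x - s) + 0 * (x - s)\<^sup>2 + 0)\<bar> \<le> C * \<epsilon> * c + u * (2 * \<eta>' * \<epsilon>)"
        if x: "x \<in> {s..s + c}" for x
      proof -
        have "\<bar>rmean (c # cs) x - sum_list (c # cs)\<bar> \<le> \<eta>' * \<epsilon>" "\<bar>rmean cs (s + c) - sum_list cs\<bar> \<le> \<eta>' * \<epsilon>"
          using E unfolding cs cs_def[symmetric] by blast+
        then have d: "\<bar>d x\<bar> \<le> 2 * \<eta>' * \<epsilon>" unfolding d_def by simp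
        have h: "\<bar>hit s x - lam 0\<bar> \<le> C * \<epsilon>" using E x s sc by auto
        have "\<bar>(hit s x - lam 0) * (x - s)\<bar> \<le> C * \<epsilon> * c"
          unfolding abs_mult using h x C E by (intro mult_mono) auto
        moreover have "\<bar>hit s x * d x\<bar> \<le> u * (2 * \<eta>' * \<epsilon>)"
          unfolding abs_mult using d hit_le[of s x] hit_nonneg[of s x] x u_pos by (intro mult_mono) auto
        moreover have "hit s x * (x - s + d x) - (lam 0 * (x - s) + 0 * (x - s)\<^sup>2 + 0)
            = (hit s x - lam 0) * (x - s) + hit s x * d x" by (simp add: algebra_simps)
        ultimately show ?thesis by linarith
      qed
      from rmean_Cons_estimate[OF c cpos this[unfolded d_def]]
      have "\<bar>rmean (c # cs) s - c - rmean cs (s + c) - (lam 0 * c\<^sup>2 / 2 + 0 * c ^ 3 / 3 + 0 * c)\<bar>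
         \<le> (C * \<epsilon> * c + u * (2 * \<eta>' * \<epsilon>)) * c" .
      also have "\<dots> = \<epsilon>\<^sup>2 * (C * b\<^sup>2 * \<epsilon> + \<eta> / 4)"
        using b u_pos by (simp add: c_def \<eta>'_def field_simps power2_eq_square)
      also have "\<dots> \<le> \<epsilon>\<^sup>2 * (\<eta> / 2)" using E by (intro mult_left_mono) auto
      finally have "\<bar>rmean (c # cs) s - c - rmean cs (s + c) - lam 0 / 2 * c\<^sup>2\<bar> \<le> \<epsilon>\<^sup>2 * (\<eta> / 2)" by simp
      moreover have "\<bar>rmean cs (s + c) - (\<Sum>c\<leftarrow>cs. c) - lam 0 / 2 * (\<Sum>c\<leftarrow>cs. c\<^sup>2)\<bar> \<le> \<eta> / 2 * \<epsilon>\<^sup>2"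
        using E sc unfolding cs_def[symmetric] by blast
      moreover have "\<epsilon>\<^sup>2 * (\<eta> / 2) + \<eta> / 2 * \<epsilon>\<^sup>2 = \<eta> * \<epsilon>\<^sup>2" by simp
      ultimately show "\<bar>rmean (c # cs) s - (\<Sum>c\<leftarrow>c # cs. c) - lam 0 / 2 * (\<Sum>c\<leftarrow>c # cs. c\<^sup>2)\<bar> \<le> \<eta> * \<epsilon>\<^sup>2"
        unfolding list.map sum_list.Cons distrib_left by linarith
    qed
  qed
qed

text \<open>The factor of \<open>l1\<close> comes from integrating the linear part of the rate. The
  coefficient 1/6 of (lam 0)^2 c^3 is -1/3 + 1/2: the decay of the hitting density, plus the loss
  lam 0 c^2 / 2 of the restarted task weighted with the probability lam 0 c of a restart.\<close>

fun cubic :: "real list \<Rightarrow> real \<Rightarrow> real" where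
  "cubic [] s = 0"
| "cubic (c # cs) s = l1 * (s * c\<^sup>2 / 2 + c ^ 3 / 3) + (lam 0)\<^sup>2 * c ^ 3 / 6 + cubic cs (s + c)"

text \<open>Second pass: by the second-order expansion the remainder \<open>d x\<close> equals the
  constant \<open>q\<close>, the expected loss on the current task, up to o(\<epsilon>^2), and
  \<open>hit\<close> is now expanded to first order.\<close>

lemma rmean_third_order:
  assumes "\<forall>b\<in>set bs. 0 < b" "0 \<le> K" "0 < \<eta>"
  shows "\<forall>\<^sub>F \<epsilon> in at_right 0. \<forall>s\<in>{0..K * \<epsilon>}.
    \<bar>rmean (map ((*) \<epsilon>) bs) s - (\<Sum>c\<leftarrow>map ((*) \<epsilon>) bs. c) - lam 0 / 2 * (\<Sum>c\<leftarrow>map ((*) \<epsilon>) bs. c\<^sup>2)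
      - cubic (map ((*) \<epsilon>) bs) s\<bar> \<le> \<eta> * \<epsilon> ^ 3"
  using assms
proof (induction bs arbitrary: K \<eta>)
  case Nil
  show ?case using eventually_pos_at_right by eventually_elim (use Nil in auto)
next
  case (Cons b bs)
  have b: "0 < b" and pos: "\<forall>b\<in>set bs. 0 < b" using Cons.prems by auto
  \<comment> \<open>The terms with \<open>\<eta>1\<close> and \<open>\<eta>2\<close> contribute an
    eighth of \<eta> each and the term with \<open>C\<close> a quarter; the other half is for the
    rest of the list.\<close>
  define \<eta>1 \<eta>2 where "\<eta>1 = \<eta> / (8 * b\<^sup>2)" and "\<eta>2 = \<eta> / (16 * u * b)"
  have \<eta>1: "0 < \<eta>1" and \<eta>2: "0 < \<eta>2" using Cons.prems b u_pos by (simp_all add: \<eta>1_def \<eta>2_def)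
  have Kb: "0 \<le> K + b" using Cons.prems b by simp
  obtain C where C: "0 \<le> C" and lip: "\<forall>\<^sub>F \<epsilon> in at_right 0. \<forall>s x. 0 \<le> s \<and> s \<le> x \<and> x \<le> (K + b) * \<epsilon> \<longrightarrow>
    \<bar>hit s x - lam 0\<bar> \<le> C * \<epsilon>" using Kb by (rule hit_lipschitz)
  note Cons.IH[OF pos Kb half_gt_zero[OF Cons.prems(3)]]
  moreover note rmean_second_order[OF Cons.prems(1) Kb \<eta>2] rmean_second_order[OF pos Kb \<eta>2] lip
    hit_expansion[OF Kb \<eta>1]
  moreover have "\<forall>\<^sub>F \<epsilon> in at_right 0. C * lam 0 / 2 * b ^ 3 * \<epsilon> \<le> \<eta> / 4"
    using Cons.prems by (intro eventually_mult_le) auto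
  ultimately show ?case using eventually_pos_at_right
  proof eventually_elim
    case (elim \<epsilon>)
    note E = elim
    define c cs where "c = \<epsilon> * b" and "cs = map ((*) \<epsilon>) bs"
    have c: "0 < c" and cpos: "\<forall>c\<in>set cs. 0 < c" using b pos E by (auto simp: c_def cs_def)
    have cs: "map ((*) \<epsilon>) (b # bs) = c # cs" by (simp add: c_def cs_def)
    show ?case unfolding cs
    proof
      fix s assume s: "s \<in> {0..K * \<epsilon>}"
      have sc: "s + c \<in> {0..(K + b) * \<epsilon>}" using s c by (auto simp: c_def algebra_simps)
      define d where "d x = rmean (c # cs) x - c - rmean cs (s + c)" for x
      define q where "q = lam 0 * c\<^sup>2 / 2"
      have q: "0 \<le> q" using lam_pos[of 0] by (simp add: q_def)
      have "\<bar>hit s x * (x - s + d x) - ((lam 0 + l1 * s) * (x - s) + (l1 - (lam 0)\<^sup>2) * (x - s)\<^sup>2 + lam 0 * q)\<bar>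
          \<le> \<eta>1 * \<epsilon> * c + u * (2 * \<eta>2 * \<epsilon>\<^sup>2) + C * \<epsilon> * q"
        if x: "x \<in> {s..s + c}" for x
      proof -
        have xK: "x \<in> {0..(K + b) * \<epsilon>}" using x s sc by auto
        have "\<bar>rmean (c # cs) x - (\<Sum>c\<leftarrow>c # cs. c) - lam 0 / 2 * (\<Sum>c\<leftarrow>c # cs. c\<^sup>2)\<bar> \<le> \<eta>2 * \<epsilon>\<^sup>2"
          "\<bar>rmean cs (s + c) - (\<Sum>c\<leftarrow>cs. c) - lam 0 / 2 * (\<Sum>c\<leftarrow>cs. c\<^sup>2)\<bar> \<le> \<eta>2 * \<epsilon>\<^sup>2"
          using E xK sc unfolding cs cs_def[symmetric] by blast+
        then have d: "\<bar>d x - q\<bar> \<le> 2 * \<eta>2 * \<epsilon>\<^sup>2" unfolding d_def q_def by (simp add: algebra_simps abs_le_iff)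
        have h: "\<bar>hit s x - lam 0\<bar> \<le> C * \<epsilon>"
          and h': "\<bar>hit s x - (lam 0 + l1 * x - (lam 0)\<^sup>2 * (x - s))\<bar> \<le> \<eta>1 * \<epsilon>"
          using E x s xK by auto
        have "\<bar>(hit s x - (lam 0 + l1 * x - (lam 0)\<^sup>2 * (x - s))) * (x - s)\<bar> \<le> \<eta>1 * \<epsilon> * c"
          unfolding abs_mult using h' x \<eta>1 E by (intro mult_mono) auto
        moreover have "\<bar>hit s x * (d x - q)\<bar> \<le> u * (2 * \<eta>2 * \<epsilon>\<^sup>2)"
          unfolding abs_mult using d hit_le[of s x] hit_nonneg[of s x] x u_pos by (intro mult_mono) auto
        moreover have "\<bar>(hit s x - lam 0) * q\<bar> \<le> C * \<epsilon> * q"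
          unfolding abs_mult using h q by (intro mult_mono) auto
        moreover have "hit s x * (x - s + d x) - ((lam 0 + l1 * s) * (x - s) + (l1 - (lam 0)\<^sup>2) * (x - s)\<^sup>2 + lam 0 * q)
            = (hit s x - (lam 0 + l1 * x - (lam 0)\<^sup>2 * (x - s))) * (x - s) + hit s x * (d x - q) + (hit s x - lam 0) * q"
          by (simp add: algebra_simps power2_eq_square)
        ultimately show ?thesis by linarith
      qed
      from rmean_Cons_estimate[OF c cpos this[unfolded d_def]]
      have "\<bar>rmean (c # cs) s - c - rmean cs (s + c)
          - ((lam 0 + l1 * s) * c\<^sup>2 / 2 + (l1 - (lam 0)\<^sup>2) * c ^ 3 / 3 + lam 0 * q * c)\<bar>
         \<le> (\<eta>1 * \<epsilon> * c + u * (2 * \<eta>2 * \<epsilon>\<^sup>2) + C * \<epsilon> * q) * c" .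
      also have "(lam 0 + l1 * s) * c\<^sup>2 / 2 + (l1 - (lam 0)\<^sup>2) * c ^ 3 / 3 + lam 0 * q * c
          = lam 0 / 2 * c\<^sup>2 + (l1 * (s * c\<^sup>2 / 2 + c ^ 3 / 3) + (lam 0)\<^sup>2 * c ^ 3 / 6)"
        by (simp add: q_def field_simps power2_eq_square power3_eq_cube)
      also have "(\<eta>1 * \<epsilon> * c + u * (2 * \<eta>2 * \<epsilon>\<^sup>2) + C * \<epsilon> * q) * c
          = \<epsilon> ^ 3 * (\<eta>1 * b\<^sup>2 + 2 * u * b * \<eta>2 + C * lam 0 / 2 * b ^ 3 * \<epsilon>)"
        by (simp add: c_def q_def field_simps power2_eq_square power3_eq_cube)
      also have "\<eta>1 * b\<^sup>2 + 2 * u * b * \<eta>2 = \<eta> / 4"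
        using b u_pos by (simp add: \<eta>1_def \<eta>2_def field_simps)
      also have "\<epsilon> ^ 3 * (\<eta> / 4 + C * lam 0 / 2 * b ^ 3 * \<epsilon>) \<le> \<epsilon> ^ 3 * (\<eta> / 2)"
      proof (rule mult_left_mono)
        have "C * lam 0 / 2 * b ^ 3 * \<epsilon> \<le> \<eta> / 4" using E by blast
        then show "\<eta> / 4 + C * lam 0 / 2 * b ^ 3 * \<epsilon> \<le> \<eta> / 2" by linarith
      qed (use E in simp)
      finally have "\<bar>rmean (c # cs) s - c - rmean cs (s + c)
          - (lam 0 / 2 * c\<^sup>2 + (l1 * (s * c\<^sup>2 / 2 + c ^ 3 / 3) + (lam 0)\<^sup>2 * c ^ 3 / 6))\<bar> \<le> \<epsilon> ^ 3 * (\<eta> / 2)" .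
      moreover have "\<bar>rmean cs (s + c) - (\<Sum>c\<leftarrow>cs. c) - lam 0 / 2 * (\<Sum>c\<leftarrow>cs. c\<^sup>2) - cubic cs (s + c)\<bar> \<le> \<eta> / 2 * \<epsilon> ^ 3"
        using E sc unfolding cs_def[symmetric] by blast
      moreover have "\<epsilon> ^ 3 * (\<eta> / 2) + \<eta> / 2 * \<epsilon> ^ 3 = \<eta> * \<epsilon> ^ 3" by simp
      ultimately show "\<bar>rmean (c # cs) s - (\<Sum>c\<leftarrow>c # cs. c) - lam 0 / 2 * (\<Sum>c\<leftarrow>c # cs. c\<^sup>2) - cubic (c # cs) s\<bar> \<le> \<eta> * \<epsilon> ^ 3"
        unfolding cubic.simps list.map sum_list.Cons distrib_left by linarith
    qed
  qed
qed

end

section \<open>Comparison of processing orders\<close>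

definition pairs :: "nat \<Rightarrow> (nat \<times> nat) set" where
  "pairs n = {(k, i). 1 \<le> k \<and> k < i \<and> i \<le> n}"

lemma finite_pairs: "finite (pairs n)"
  by (rule finite_subset[of _ "{1..n} \<times> {1..n}"]) (auto simp: pairs_def)

lemma sum_pairs: "(\<Sum>i=1..n. \<Sum>k=1..<i. F k i) = (\<Sum>(k, i)\<in>pairs n. F k i)"
proof -
  have "(\<Sum>i=1..n. \<Sum>k=1..<i. F k i) = (\<Sum>(i, k)\<in>(SIGMA i:{1..n}. {1..<i}). F k i)"
    by (rule sum.Sigma) auto
  also have "\<dots> = (\<Sum>(k, i)\<in>pairs n. F k i)"
    by (rule sum.reindex_bij_witness[of _ prod.swap prod.swap]) (auto simp: pairs_def)
  finally show ?thesis .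
qed

lemma pairs_permuted:
  assumes "\<pi> permutes {1..n}" "(k, i) \<in> pairs n"
  shows "\<pi> k \<in> {1..n}" "\<pi> i \<in> {1..n}" "\<pi> k \<noteq> \<pi> i"
proof -
  have "k \<in> {1..n}" "i \<in> {1..n}" "k \<noteq> i" using assms(2) by (auto simp: pairs_def)
  then show "\<pi> k \<in> {1..n}" "\<pi> i \<in> {1..n}" "\<pi> k \<noteq> \<pi> i"
    using permutes_in_image[OF assms(1)] inj_eq[OF permutes_inj[OF assms(1)]] by blast+
qed

text \<open>Sorting the two entries of each image pair maps \<open>pairs n\<close> bijectively onto
  itself. Hence the cost of any order can be compared term by term with that of the sorted
  order.\<close>

lemma sum_pairs_permute:
  fixes F :: "nat \<Rightarrow> nat \<Rightarrow> real"
  assumes \<pi>: "\<pi> permutes {1..n}"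
  shows "(\<Sum>(k, i)\<in>pairs n. F (min (\<pi> k) (\<pi> i)) (max (\<pi> k) (\<pi> i))) = (\<Sum>(k, i)\<in>pairs n. F k i)"
proof -
  let ?\<phi> = "\<lambda>(k, i). (min (\<pi> k) (\<pi> i), max (\<pi> k) (\<pi> i))"
  have eq: "\<pi> i = \<pi> j \<longleftrightarrow> i = j" for i j using inj_eq[OF permutes_inj[OF \<pi>]] .
  have inj: "inj_on ?\<phi> (pairs n)"
  proof (rule inj_onI)
    fix p q assume "p \<in> pairs n" "q \<in> pairs n" "?\<phi> p = ?\<phi> q"
    then show "p = q"
      by (auto simp: pairs_def min_def max_def eq split: if_splits)
  qed
  have "?\<phi> p \<in> pairs n" if "p \<in> pairs n" for p
  proof -
    obtain k i where p: "p = (k, i)" by (cases p)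
    with that have "(k, i) \<in> pairs n" by simp
    from pairs_permuted[OF \<pi> this] show ?thesis by (auto simp: p pairs_def)
  qed
  then have "?\<phi> ` pairs n = pairs n"
    using inj by (intro endo_inj_surj finite_pairs) auto
  then have "(\<Sum>(k, i)\<in>pairs n. F k i) = (\<Sum>p\<in>pairs n. (\<lambda>(k, i). F k i) (?\<phi> p))"
    using sum.reindex[OF inj, of "\<lambda>(k, i). F k i"] by (simp add: o_def)
  then show ?thesis by (simp add: case_prod_unfold)
qed

text \<open>Without an inversion \<pi> would be strictly increasing on \<open>{1..n}\<close>, so i
  <= \<pi> i throughout, which only the identity satisfies.\<close>

lemma permutes_inversion:
  assumes \<pi>: "\<pi> permutes {1..n}" and "\<pi> \<noteq> id"
  obtains k i where "(k, i) \<in> pairs n" "\<pi> i < \<pi> k"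
proof -
  have "\<exists>k i. (k, i) \<in> pairs n \<and> \<pi> i < \<pi> k"
  proof (rule ccontr)
    assume no: "\<not> ?thesis"
    have "i \<le> \<pi> i" if "i \<in> {1..n}" for i
      using that
    proof (induction i)
      case (Suc i)
      show ?case
      proof (cases "i = 0")
        case True
        then show ?thesis using permutes_in_image[OF \<pi>, of "Suc i"] Suc.prems by simp
      next
        case False
        then have "(i, Suc i) \<in> pairs n" using Suc.prems by (simp add: pairs_def)
        with no have "\<pi> i \<le> \<pi> (Suc i)" by (meson not_le)
        moreover have "\<pi> i \<noteq> \<pi> (Suc i)" by (simp add: inj_eq[OF permutes_inj[OF \<pi>]])
        moreover have "i \<le> \<pi> i" using Suc False by simp
        ultimately show ?thesis by simp
      qed
    qed simp
    then have "\<pi> = id" using \<pi> by (intro permutes_natset_ge) auto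
    with assms(2) show False ..
  qed
  then show ?thesis using that by blast
qed

definition order_cost :: "nat \<Rightarrow> (nat \<Rightarrow> real) \<Rightarrow> real" where
  "order_cost n g = (\<Sum>i=1..n. (\<Sum>k=1..<i. g k) * (g i)\<^sup>2)"

lemma order_cost_pairs: "order_cost n g = (\<Sum>(k, i)\<in>pairs n. g k * (g i)\<^sup>2)"
  unfolding order_cost_def sum_pairs[symmetric] by (simp add: sum_distrib_right)

lemma mult_power2_less:
  fixes x y :: real
  assumes "0 < x" "x < y"
  shows "y * x\<^sup>2 < x * y\<^sup>2"
proof -
  have "(x * y) * x < (x * y) * y" using assms by (intro mult_strict_left_mono) auto
  then show ?thesis by (simp add: power2_eq_square mult_ac)
qed

text \<open>No unordered pair of tasks contributes more than it does in increasing order, an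
  inverted pair contributes strictly less, and some inversion exists.\<close>

lemma order_cost_increasing:
  assumes \<pi>: "\<pi> permutes {1..n}" "\<pi> \<noteq> id"
    and pos: "\<forall>i\<in>{1..n}. 0 < a i" and mono: "\<forall>i\<in>{1..n}. \<forall>j\<in>{1..n}. i < j \<longrightarrow> a i < a j"
  shows "order_cost n (\<lambda>i. a (\<pi> i)) < order_cost n a"
proof -
  let ?F = "\<lambda>k i. a k * (a i)\<^sup>2"
  have strict: "?F (\<pi> k) (\<pi> i) < ?F (\<pi> i) (\<pi> k)" if "(k, i) \<in> pairs n" "\<pi> i < \<pi> k" for k i
    using pairs_permuted[OF \<pi>(1) that(1)] that(2) pos mono by (intro mult_power2_less) auto
  obtain k i where inv: "(k, i) \<in> pairs n" "\<pi> i < \<pi> k" using permutes_inversion[OF \<pi>] .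
  have "(\<Sum>(k, i)\<in>pairs n. ?F (\<pi> k) (\<pi> i)) < (\<Sum>(k, i)\<in>pairs n. ?F (min (\<pi> k) (\<pi> i)) (max (\<pi> k) (\<pi> i)))"
  proof (rule sum_strict_mono_ex1[OF finite_pairs])
    show "\<forall>x\<in>pairs n. (case x of (k, i) \<Rightarrow> ?F (\<pi> k) (\<pi> i)) \<le> (case x of (k, i) \<Rightarrow> ?F (min (\<pi> k) (\<pi> i)) (max (\<pi> k) (\<pi> i)))"
      using strict by (auto simp: min_def max_def less_imp_le not_le)
    show "\<exists>x\<in>pairs n. (case x of (k, i) \<Rightarrow> ?F (\<pi> k) (\<pi> i)) < (case x of (k, i) \<Rightarrow> ?F (min (\<pi> k) (\<pi> i)) (max (\<pi> k) (\<pi> i)))"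
      using strict[OF inv] inv by (intro bexI[of _ "(k, i)"]) (auto simp: min_def max_def)
  qed
  then show ?thesis unfolding order_cost_pairs sum_pairs_permute[OF \<pi>(1), of ?F] .
qed

lemma order_cost_decreasing:
  assumes \<pi>: "\<pi> permutes {1..n}" "\<pi> \<noteq> id"
    and pos: "\<forall>i\<in>{1..n}. 0 < a i" and mono: "\<forall>i\<in>{1..n}. \<forall>j\<in>{1..n}. i < j \<longrightarrow> a j < a i"
  shows "order_cost n a < order_cost n (\<lambda>i. a (\<pi> i))"
proof -
  let ?F = "\<lambda>k i. a k * (a i)\<^sup>2"
  have strict: "?F (\<pi> i) (\<pi> k) < ?F (\<pi> k) (\<pi> i)" if "(k, i) \<in> pairs n" "\<pi> i < \<pi> k" for k i
    using pairs_permuted[OF \<pi>(1) that(1)] that(2) pos mono by (intro mult_power2_less) auto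
  obtain k i where inv: "(k, i) \<in> pairs n" "\<pi> i < \<pi> k" using permutes_inversion[OF \<pi>] .
  have "(\<Sum>(k, i)\<in>pairs n. ?F (min (\<pi> k) (\<pi> i)) (max (\<pi> k) (\<pi> i))) < (\<Sum>(k, i)\<in>pairs n. ?F (\<pi> k) (\<pi> i))"
  proof (rule sum_strict_mono_ex1[OF finite_pairs])
    show "\<forall>x\<in>pairs n. (case x of (k, i) \<Rightarrow> ?F (min (\<pi> k) (\<pi> i)) (max (\<pi> k) (\<pi> i))) \<le> (case x of (k, i) \<Rightarrow> ?F (\<pi> k) (\<pi> i))"
      using strict by (auto simp: min_def max_def less_imp_le not_le)
    show "\<exists>x\<in>pairs n. (case x of (k, i) \<Rightarrow> ?F (min (\<pi> k) (\<pi> i)) (max (\<pi> k) (\<pi> i))) < (case x of (k, i) \<Rightarrow> ?F (\<pi> k) (\<pi> i))"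
      using strict[OF inv] inv by (intro bexI[of _ "(k, i)"]) (auto simp: min_def max_def)
  qed
  then show ?thesis unfolding order_cost_pairs sum_pairs_permute[OF \<pi>(1), of ?F] .
qed

text \<open>With A the sum before a: a (A + a)^2 = ((A + a)^3 - A^3) / 3 + A a^2 + 2 a^3 / 3, and
  the cubes telescope.\<close>

lemma sum_mult_partial_sum_squared:
  fixes g :: "nat \<Rightarrow> real"
  shows "(\<Sum>i=1..n. g i * (\<Sum>k=1..i. g k)\<^sup>2)
    = (\<Sum>i=1..n. g i) ^ 3 / 3 + order_cost n g + 2 / 3 * (\<Sum>i=1..n. (g i) ^ 3)"
proof (induction n)
  case 0
  show ?case by (simp add: order_cost_def)
next
  case (Suc n)
  have "order_cost (Suc n) g = order_cost n g + (\<Sum>k=1..n. g k) * (g (Suc n))\<^sup>2"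
    by (simp add: order_cost_def atLeastLessThanSuc_atLeastAtMost)
  with Suc show ?case by (simp add: power2_eq_square power3_eq_cube field_simps)
qed

lemma sum_compose_permutes:
  fixes F :: "real \<Rightarrow> real"
  assumes "\<pi> permutes {1..n}"
  shows "(\<Sum>i=1..n. F (a (\<pi> i))) = (\<Sum>i=1..n. F (a i))"
  using sum.permute[OF assms, of "\<lambda>i. F (a i)"] by (simp add: o_def)

text \<open>Turns the denominators in the hypotheses of the theorem into differences of
  \<open>order_cost\<close>; the other terms are symmetric in the tasks and cancel.\<close>

lemma sum_mult_partial_sum_squared_diff:
  fixes a :: "nat \<Rightarrow> real"
  assumes "\<pi> permutes {1..n}" "\<sigma> permutes {1..n}"
  shows "(\<Sum>i=1..n. a (\<sigma> i) * (\<Sum>k=1..i. a (\<sigma> k))\<^sup>2) - (\<Sum>i=1..n. a (\<pi> i) * (\<Sum>k=1..i. a (\<pi> k))\<^sup>2)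
    = order_cost n (\<lambda>i. a (\<sigma> i)) - order_cost n (\<lambda>i. a (\<pi> i))"
  unfolding sum_mult_partial_sum_squared
  using sum_compose_permutes[OF assms(1), of "\<lambda>x. x" a] sum_compose_permutes[OF assms(2), of "\<lambda>x. x" a]
    sum_compose_permutes[OF assms(1), of "\<lambda>x. x ^ 3" a] sum_compose_permutes[OF assms(2), of "\<lambda>x. x ^ 3" a]
  by simp

lemma rev_perm_rev_perm [simp]: "rev_perm n (rev_perm n i) = i"
  by (auto simp: rev_perm_def)

lemma rev_perm_permutes: "rev_perm n permutes {1..n}"
proof (rule bij_imp_permutes)
  show "bij_betw (rev_perm n) {1..n} {1..n}"
    by (rule bij_betw_byWitness[of _ "rev_perm n"]) (auto simp: rev_perm_def)
qed (auto simp: rev_perm_def)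

text \<open>Relabelling the tasks by the reversal turns the increasing lengths into decreasing ones.\<close>
lemma order_cost_rev_perm:
  assumes \<pi>: "\<pi> permutes {1..n}" "\<pi> \<noteq> rev_perm n"
    and pos: "\<forall>i\<in>{1..n}. 0 < a i" and mono: "\<forall>i\<in>{1..n}. \<forall>j\<in>{1..n}. i < j \<longrightarrow> a i < a j"
  shows "order_cost n (\<lambda>i. a (rev_perm n i)) < order_cost n (\<lambda>i. a (\<pi> i))"
proof -
  let ?\<sigma> = "rev_perm n \<circ> \<pi>"
  have "?\<sigma> \<noteq> id"
  proof
    assume eq: "?\<sigma> = id"
    have "\<pi> i = rev_perm n i" for i
      using fun_cong[OF eq, of i] rev_perm_rev_perm[of n "\<pi> i"] by simp
    with \<pi>(2) show False by blast
  qed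
  moreover have "?\<sigma> permutes {1..n}" using \<pi>(1) rev_perm_permutes by (rule permutes_compose)
  moreover have "\<forall>i\<in>{1..n}. 0 < a (rev_perm n i)"
    "\<forall>i\<in>{1..n}. \<forall>j\<in>{1..n}. i < j \<longrightarrow> a (rev_perm n j) < a (rev_perm n i)"
  proof -
    have "rev_perm n i \<in> {1..n}" if "i \<in> {1..n}" for i
      using that by (auto simp: rev_perm_def)
    moreover have "rev_perm n j < rev_perm n i" if "i \<in> {1..n}" "j \<in> {1..n}" "i < j" for i j
      using that by (auto simp: rev_perm_def)
    ultimately show "\<forall>i\<in>{1..n}. 0 < a (rev_perm n i)"
      "\<forall>i\<in>{1..n}. \<forall>j\<in>{1..n}. i < j \<longrightarrow> a (rev_perm n j) < a (rev_perm n i)"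
      using pos mono by blast+
  qed
  ultimately have "order_cost n (\<lambda>i. a (rev_perm n i)) < order_cost n (\<lambda>i. a (rev_perm n (?\<sigma> i)))"
    by (intro order_cost_decreasing[where a = "\<lambda>i. a (rev_perm n i)"])
  then show ?thesis by simp
qed

text \<open>Brings the LPT sum in the hypothesis of the second claim into the form of the sums for a
  permutation, with \<open>k\<close> counted from the front of the processing order.\<close>

lemma reversed_sum:
  fixes a :: "nat \<Rightarrow> real"
  shows "(\<Sum>i=1..n. a (n + 1 - i) * (\<Sum>k=n+1-i..n. a k)\<^sup>2)
    = (\<Sum>i=1..n. a (rev_perm n i) * (\<Sum>k=1..i. a (rev_perm n k))\<^sup>2)"
proof (rule sum.cong[OF refl])
  fix i assume i: "i \<in> {1..n}"
  have "(\<Sum>k=n+1-i..n. a k) = (\<Sum>k=1..i. a (rev_perm n k))"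
    using i by (intro sum.reindex_bij_witness[of _ "rev_perm n" "rev_perm n"]) (auto simp: rev_perm_def)
  then show "a (n + 1 - i) * (\<Sum>k=n+1-i..n. a k)\<^sup>2 = a (rev_perm n i) * (\<Sum>k=1..i. a (rev_perm n k))\<^sup>2"
    using i by (simp add: rev_perm_def)
qed

section \<open>The order-dependent term on lists and the comparison of expectations\<close>

fun delay :: "real list \<Rightarrow> real \<Rightarrow> real" where
  "delay [] s = 0"
| "delay (c # cs) s = s * c\<^sup>2 + delay cs (s + c)"

lemma delay_snoc: "delay (cs @ [c]) s = delay cs s + (s + sum_list cs) * c\<^sup>2"
  by (induction cs arbitrary: s) (auto simp: algebra_simps)

lemma delay_scale: "delay (map ((*) \<epsilon>) cs) (\<epsilon> * s) = \<epsilon> ^ 3 * delay cs s"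
proof (induction cs arbitrary: s)
  case (Cons c cs)
  have "\<epsilon> * s + \<epsilon> * c = \<epsilon> * (s + c)" by (simp add: algebra_simps)
  then show ?case using Cons[of "s + c"]
    by (simp add: algebra_simps power2_eq_square power3_eq_cube)
qed simp

lemma sum_list_interval: "(\<Sum>i\<leftarrow>[1..<Suc n]. g i) = (\<Sum>i=1..n. g i)"
  by (simp add: interv_sum_list_conv_sum_set_nat atLeastLessThanSuc_atLeastAtMost del: upt_Suc)

lemma delay_eq_order_cost: "delay (map g [1..<Suc n]) 0 = order_cost n g"
proof (induction n)
  case 0
  show ?case by (simp add: order_cost_def)
next
  case (Suc n)
  have "[1..<Suc (Suc n)] = [1..<Suc n] @ [Suc n]" by simp
  then have "delay (map g [1..<Suc (Suc n)]) 0 = delay (map g [1..<Suc n]) 0 + sum_list (map g [1..<Suc n]) * (g (Suc n))\<^sup>2"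
    by (simp add: delay_snoc del: upt_Suc)
  also have "\<dots> = order_cost n g + (\<Sum>k=1..n. g k) * (g (Suc n))\<^sup>2"
    unfolding Suc sum_list_interval ..
  finally show ?case by (simp add: order_cost_def atLeastLessThanSuc_atLeastAtMost)
qed

context hazard_deriv
begin

lemma cubic_eq_delay:
  "cubic cs s = l1 / 2 * delay cs s + (l1 / 3 + (lam 0)\<^sup>2 / 6) * (\<Sum>c\<leftarrow>cs. c ^ 3)"
  by (induction cs arbitrary: s) (auto simp: field_simps)

lemma rmean_less:
  assumes pos: "\<forall>b\<in>set bs. 0 < b" "\<forall>b\<in>set bs'. 0 < b"
    and pow: "\<And>m. (\<Sum>b\<leftarrow>bs. b ^ m) = (\<Sum>b\<leftarrow>bs'. b ^ m)"
    and less: "l1 * delay bs 0 < l1 * delay bs' 0"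
  shows "\<forall>\<^sub>F \<epsilon> in at_right 0. rmean (map ((*) \<epsilon>) bs) 0 < rmean (map ((*) \<epsilon>) bs') 0"
proof -
  \<comment> \<open>The cubic terms then differ by 4 \<eta> \<epsilon>^3, of which the two
    approximation errors use up at most half.\<close>
  define \<eta> where "\<eta> = (l1 * delay bs' 0 - l1 * delay bs 0) / 8"
  have \<eta>: "0 < \<eta>" using less by (simp add: \<eta>_def)
  have scale: "(\<Sum>c\<leftarrow>map ((*) \<epsilon>) cs. c ^ m) = \<epsilon> ^ m * (\<Sum>b\<leftarrow>cs. b ^ m)" for \<epsilon> :: real and m cs
    by (induction cs) (auto simp: algebra_simps power_mult_distrib)
  have pow': "(\<Sum>c\<leftarrow>map ((*) \<epsilon>) bs. c ^ m) = (\<Sum>c\<leftarrow>map ((*) \<epsilon>) bs'. c ^ m)" for \<epsilon> m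
    unfolding scale pow ..
  show ?thesis
    using rmean_third_order[OF pos(1) order_refl \<eta>] rmean_third_order[OF pos(2) order_refl \<eta>]
      eventually_pos_at_right
  proof eventually_elim
    case (elim \<epsilon>)
    let ?p = "(\<Sum>c\<leftarrow>map ((*) \<epsilon>) bs'. c) + lam 0 / 2 * (\<Sum>c\<leftarrow>map ((*) \<epsilon>) bs'. c\<^sup>2)"
    let ?q = "(l1 / 3 + (lam 0)\<^sup>2 / 6) * (\<Sum>c\<leftarrow>map ((*) \<epsilon>) bs'. c ^ 3)"
    have lin: "(\<Sum>c\<leftarrow>map ((*) \<epsilon>) bs. c) = (\<Sum>c\<leftarrow>map ((*) \<epsilon>) bs'. c)"
      using pow'[where m = 1 and \<epsilon> = \<epsilon>] by simp
    have cub: "cubic (map ((*) \<epsilon>) bs) 0 = l1 / 2 * (\<epsilon> ^ 3 * delay bs 0) + ?q"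
      "cubic (map ((*) \<epsilon>) bs') 0 = l1 / 2 * (\<epsilon> ^ 3 * delay bs' 0) + ?q"
      unfolding cubic_eq_delay using delay_scale[of \<epsilon> _ 0] pow'[where m = 3 and \<epsilon> = \<epsilon>] by simp_all
    have "\<bar>rmean (map ((*) \<epsilon>) bs) 0 - ?p - cubic (map ((*) \<epsilon>) bs) 0\<bar> \<le> \<eta> * \<epsilon> ^ 3"
      using elim(1) lin pow'[where m = 2 and \<epsilon> = \<epsilon>] by (simp add: algebra_simps)
    moreover have "\<bar>rmean (map ((*) \<epsilon>) bs') 0 - ?p - cubic (map ((*) \<epsilon>) bs') 0\<bar> \<le> \<eta> * \<epsilon> ^ 3"
      using elim(2) by (simp add: algebra_simps)
    moreover have "cubic (map ((*) \<epsilon>) bs') 0 - cubic (map ((*) \<epsilon>) bs) 0 = 4 * (\<eta> * \<epsilon> ^ 3)"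
      unfolding cub \<eta>_def by (simp add: field_simps)
    moreover have "0 < \<eta> * \<epsilon> ^ 3" using \<eta> elim(3) by simp
    ultimately show ?case by linarith
  qed
qed

end

section \<open>From the given intensity to a hazard rate on the whole line\<close>

lemma intensity_hazard:
  fixes f f' :: "real \<Rightarrow> real"
  assumes lbar: "lbar > 0"
    and deriv: "\<forall>t\<ge>0. (f has_real_derivative f' t) (at t within {0..})"
    and f_inf: "Inf (f ` {0..}) > 0" and f_sup: "bdd_above (f ` {0..})"
    and f_pos: "\<forall>t\<ge>0. f t > 0"
  obtains lam Lam l u where "hazard_deriv lam Lam l u (lbar * f' 0)"
    "\<And>t. 0 \<le> t \<Longrightarrow> cum_int (\<lambda>t. lbar * f t) t = Lam t"
proof -
  \<comment> \<open>Freezing the rate at its value at 0 for negative times preserves continuity and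
    the bounds on \<open>f\<close>.\<close>
  define lam where "lam x = lbar * f (max x 0)" for x
  have f_cont: "continuous_on {0..} f"
    using deriv by (intro DERIV_continuous_on) auto
  have "continuous_on UNIV (f \<circ> (\<lambda>x. max x 0))"
    by (intro continuous_on_compose continuous_on_max continuous_on_id continuous_on_const
        continuous_on_subset[OF f_cont]) auto
  then have cont: "continuous_on UNIV lam"
    unfolding lam_def comp_def by (rule continuous_on_mult_left)
  then have "isCont lam x" for x by (simp add: continuous_on_eq_continuous_at)
  \<comment> \<open>An antiderivative on the whole line, normalized at 0 only afterwards; on
    nonnegative times it then agrees with \<open>cum_int\<close>.\<close>
  then obtain F where F: "\<And>x. (F has_real_derivative lam x) (at x)"
    using einterval_antiderivative[of "-\<infinity>" \<infinity> lam] by (auto simp: has_real_derivative_iff_has_vector_derivative)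
  define Lam where "Lam x = F x - F 0" for x
  have Lam: "(Lam has_real_derivative lam x) (at x)" for x
    unfolding Lam_def by (auto intro!: derivative_eq_intros F)
  have bdd: "bdd_below (f ` {0..})" using f_pos by (intro bdd_belowI2[of _ 0]) (auto intro: less_imp_le)
  have "(lam has_real_derivative lbar * f' 0) (at 0 within {0..})"
  proof (rule has_field_derivative_transform_within[where d = 1])
    show "((\<lambda>x. lbar * f x) has_real_derivative lbar * f' 0) (at 0 within {0..})"
      using deriv by (intro DERIV_cmult) auto
  qed (auto simp: lam_def max_def)
  then have "hazard_deriv lam Lam (lbar * Inf (f ` {0..})) (lbar * Sup (f ` {0..})) (lbar * f' 0)"
    using lbar f_inf cont Lam bdd f_sup
    by unfold_locales (auto simp: Lam_def lam_def intro!: mult_left_mono cINF_lower cSUP_upper)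
  moreover have "cum_int (\<lambda>t. lbar * f t) t = Lam t" if "0 \<le> t" for t
  proof -
    have "(lam has_integral Lam t - Lam 0) {0..t}"
      using that Lam by (intro fundamental_theorem_of_calculus)
        (auto simp: has_real_derivative_iff_has_vector_derivative has_vector_derivative_at_within)
    then have "((\<lambda>t. lbar * f t) has_integral Lam t) {0..t}"
      by (subst has_integral_cong[of _ _ lam]) (auto simp: lam_def Lam_def)
    then show ?thesis unfolding cum_int_def by (rule integral_unique)
  qed
  ultimately show ?thesis using that by blast
qed

context hazard_deriv
begin

lemma exp_makespan_task_seq_less:
  assumes r: "\<And>t. 0 \<le> t \<Longrightarrow> cum_int r t = Lam t"
    and a: "\<forall>i\<in>{1..n}. 0 < a i" and \<sigma>: "\<sigma> permutes {1..n}" and \<pi>: "\<pi> permutes {1..n}"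
    and less: "l1 * order_cost n (\<lambda>i. a (\<sigma> i)) < l1 * order_cost n (\<lambda>i. a (\<pi> i))"
  shows "\<forall>\<^sub>F \<epsilon> in at_right 0. exp_makespan r (task_seq \<epsilon> a n \<sigma>) 0 < exp_makespan r (task_seq \<epsilon> a n \<pi>) 0"
proof -
  define bs where "bs \<tau> = map (\<lambda>i. a (\<tau> i)) [1..<Suc n]" for \<tau> :: "nat \<Rightarrow> nat"
  have seq: "task_seq \<epsilon> a n \<tau> = map ((*) \<epsilon>) (bs \<tau>)" for \<epsilon> \<tau>
    by (simp add: task_seq_def bs_def del: upt_Suc)
  have pos: "\<forall>b\<in>set (bs \<tau>). 0 < b" if "\<tau> permutes {1..n}" for \<tau>
  proof -
    have "\<tau> i \<in> {1..n}" if "i \<in> {1..n}" for i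
      using permutes_in_image[OF \<open>\<tau> permutes {1..n}\<close>] that by blast
    then show ?thesis using a unfolding bs_def set_map set_upt by fastforce
  qed
  have pow: "(\<Sum>b\<leftarrow>bs \<tau>. b ^ m) = (\<Sum>i=1..n. a i ^ m)" if "\<tau> permutes {1..n}" for \<tau> m
  proof -
    have "(\<Sum>b\<leftarrow>bs \<tau>. b ^ m) = (\<Sum>i\<leftarrow>[1..<Suc n]. a (\<tau> i) ^ m)"
      unfolding bs_def map_map comp_def ..
    then show ?thesis
      unfolding sum_list_interval using sum_compose_permutes[OF that, of "\<lambda>x. x ^ m" a] by simp
  qed
  have "\<forall>\<^sub>F \<epsilon> in at_right 0. rmean (map ((*) \<epsilon>) (bs \<sigma>)) 0 < rmean (map ((*) \<epsilon>) (bs \<pi>)) 0"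
  proof (rule rmean_less[OF pos[OF \<sigma>] pos[OF \<pi>]])
    show "(\<Sum>b\<leftarrow>bs \<sigma>. b ^ m) = (\<Sum>b\<leftarrow>bs \<pi>. b ^ m)" for m
      unfolding pow[OF \<sigma>] pow[OF \<pi>] ..
    show "l1 * delay (bs \<sigma>) 0 < l1 * delay (bs \<pi>) 0"
      using less unfolding bs_def delay_eq_order_cost .
  qed
  then show ?thesis using eventually_pos_at_right
  proof eventually_elim
    case (elim \<epsilon>)
    have "exp_makespan r (task_seq \<epsilon> a n \<tau>) 0 = ennreal (rmean (map ((*) \<epsilon>) (bs \<tau>)) 0)"
      if "\<tau> permutes {1..n}" for \<tau>
      unfolding seq using pos[OF that] elim by (intro exp_makespan_eq_mean r) auto
    then show ?case using elim(1) rmean_nonneg \<sigma> \<pi> by (simp add: ennreal_less_iff)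
  qed
qed

text \<open>There are finitely many permutations, so one threshold \<open>\<epsilon>0\<close> serves
  all of them.\<close>

lemma exp_makespan_optimal:
  assumes r: "\<And>t. 0 \<le> t \<Longrightarrow> cum_int r t = Lam t"
    and a: "\<forall>i\<in>{1..n}. 0 < a i" and \<sigma>: "\<sigma> permutes {1..n}"
    and less: "\<And>\<pi>. \<pi> permutes {1..n} \<Longrightarrow> \<pi> \<noteq> \<sigma> \<Longrightarrow>
      l1 * order_cost n (\<lambda>i. a (\<sigma> i)) < l1 * order_cost n (\<lambda>i. a (\<pi> i))"
  shows "\<exists>\<epsilon>0>0. \<forall>\<epsilon>. 0 < \<epsilon> \<and> \<epsilon> < \<epsilon>0 \<longrightarrow> (\<forall>\<pi>. \<pi> permutes {1..n} \<and> \<pi> \<noteq> \<sigma> \<longrightarrow>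
    exp_makespan r (task_seq \<epsilon> a n \<sigma>) 0 < exp_makespan r (task_seq \<epsilon> a n \<pi>) 0)"
proof -
  have "finite {\<pi>. \<pi> permutes {1..n} \<and> \<pi> \<noteq> \<sigma>}"
    by (rule finite_subset[OF _ finite_permutations[of "{1..n}"]]) auto
  then have "\<forall>\<^sub>F \<epsilon> in at_right 0. \<forall>\<pi>\<in>{\<pi>. \<pi> permutes {1..n} \<and> \<pi> \<noteq> \<sigma>}.
    exp_makespan r (task_seq \<epsilon> a n \<sigma>) 0 < exp_makespan r (task_seq \<epsilon> a n \<pi>) 0"
    using exp_makespan_task_seq_less[OF r a \<sigma>] less by (intro eventually_ball_finite) auto
  then show ?thesis unfolding eventually_at_right_field by auto
qed

end

theorem theorem2:
  fixes n :: nat and abar :: "nat \<Rightarrow> real" and lbar :: real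
    and f f' :: "real \<Rightarrow> real"
  assumes abar_pos: "\<forall>i\<in>{1..n}. abar i > 0"
    and abar_incr: "\<forall>i\<in>{1..n}. \<forall>j\<in>{1..n}. i < j \<longrightarrow> abar i < abar j"
    and lbar_pos: "lbar > 0"
    and f_pos: "\<forall>t\<ge>0. f t > 0"
    and f_deriv: "\<forall>t\<ge>0. (f has_real_derivative f' t) (at t within {0..})"
    and f_inf: "Inf (f ` {0..}) > 0"
    and f_sup: "bdd_above (f ` {0..})"
  shows
   "((\<exists>\<delta>>0. \<forall>s\<in>{0..\<delta>}. \<forall>t\<in>{0..\<delta>}. s < t \<longrightarrow> f t < f s) \<and>
     (\<forall>\<pi>. \<pi> permutes {1..n} \<and> \<pi> \<noteq> id \<longrightarrow>
        \<bar>f' 0\<bar> > 2 * lbar * ((Sup (f ` {0..}))\<^sup>2 * (\<Sum>k=1..n. abar k) * (\<Sum>i=1..n. (abar i)\<^sup>2)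
                     + (Sup (f ` {0..}))\<^sup>2 * (3/4) * (\<Sum>k=1..n. abar k) ^ 3)
          / ((\<Sum>i=1..n. abar i * (\<Sum>k=1..i. abar k)\<^sup>2)
             - (\<Sum>i=1..n. abar (\<pi> i) * (\<Sum>k=1..i. abar (\<pi> k))\<^sup>2)))
    \<longrightarrow> (\<exists>\<epsilon>0>0. \<forall>\<epsilon>. 0 < \<epsilon> \<and> \<epsilon> < \<epsilon>0 \<longrightarrow>
          (\<forall>\<pi>. \<pi> permutes {1..n} \<and> \<pi> \<noteq> id \<longrightarrow>
             exp_makespan (\<lambda>t. lbar * f t) (task_seq \<epsilon> abar n id) 0
               < exp_makespan (\<lambda>t. lbar * f t) (task_seq \<epsilon> abar n \<pi>) 0)))
   \<and>
   ((\<exists>\<delta>>0. \<forall>s\<in>{0..\<delta>}. \<forall>t\<in>{0..\<delta>}. s < t \<longrightarrow> f s < f t) \<and>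
     (\<forall>\<pi>. \<pi> permutes {1..n} \<and> \<pi> \<noteq> rev_perm n \<longrightarrow>
        f' 0 > 2 * lbar * ((Sup (f ` {0..}))\<^sup>2 * (\<Sum>k=1..n. abar k) * (\<Sum>i=1..n. (abar i)\<^sup>2)
                     + (Sup (f ` {0..}))\<^sup>2 * (3/4) * (\<Sum>k=1..n. abar k) ^ 3)
          / ((\<Sum>i=1..n. abar (\<pi> i) * (\<Sum>k=1..i. abar (\<pi> k))\<^sup>2)
             - (\<Sum>i=1..n. abar (n + 1 - i) * (\<Sum>k=n+1-i..n. abar k)\<^sup>2)))
    \<longrightarrow> (\<exists>\<epsilon>0>0. \<forall>\<epsilon>. 0 < \<epsilon> \<and> \<epsilon> < \<epsilon>0 \<longrightarrow>
          (\<forall>\<pi>. \<pi> permutes {1..n} \<and> \<pi> \<noteq> rev_perm n \<longrightarrow>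
             exp_makespan (\<lambda>t. lbar * f t) (task_seq \<epsilon> abar n (rev_perm n)) 0
               < exp_makespan (\<lambda>t. lbar * f t) (task_seq \<epsilon> abar n \<pi>) 0)))"
proof -
  obtain lam Lam l u where haz: "hazard_deriv lam Lam l u (lbar * f' 0)"
    and cum: "\<And>t. 0 \<le> t \<Longrightarrow> cum_int (\<lambda>t. lbar * f t) t = Lam t"
    using intensity_hazard[OF lbar_pos f_deriv f_inf f_sup f_pos] by blast
  interpret hazard_deriv lam Lam l u "lbar * f' 0" by (rule haz)
  let ?N = "2 * lbar * ((Sup (f ` {0..}))\<^sup>2 * (\<Sum>k=1..n. abar k) * (\<Sum>i=1..n. (abar i)\<^sup>2)
                     + (Sup (f ` {0..}))\<^sup>2 * (3/4) * (\<Sum>k=1..n. abar k) ^ 3)"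
  have "0 \<le> (\<Sum>k=1..n. abar k)" using abar_pos by (intro sum_nonneg) (auto intro: less_imp_le)
  moreover have "0 \<le> (\<Sum>i=1..n. (abar i)\<^sup>2)" by (intro sum_nonneg) simp
  ultimately have N: "0 \<le> ?N"
    using lbar_pos by (auto intro!: mult_nonneg_nonneg add_nonneg_nonneg)
  have f0: "(f has_real_derivative f' 0) (at 0 within {0..})" using f_deriv by simp
  note id = permutes_id[of "{1..n}"]
  show ?thesis
  proof (intro conjI impI; elim conjE exE)
    fix \<delta> :: real
    assume dec: "0 < \<delta>" "\<forall>s\<in>{0..\<delta>}. \<forall>t\<in>{0..\<delta>}. s < t \<longrightarrow> f t < f s"
      and bound: "\<forall>\<pi>. \<pi> permutes {1..n} \<and> \<pi> \<noteq> id \<longrightarrow> \<bar>f' 0\<bar> > ?N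
          / ((\<Sum>i=1..n. abar i * (\<Sum>k=1..i. abar k)\<^sup>2)
             - (\<Sum>i=1..n. abar (\<pi> i) * (\<Sum>k=1..i. abar (\<pi> k))\<^sup>2))"
    \<comment> \<open>Strict decrease near 0 yields only the weak sign; the lower bound on
      \<open>\<bar>f' 0\<bar>\<close> then excludes 0.\<close>
    have le: "f' 0 \<le> 0"
    proof (rule ccontr)
      assume "\<not> f' 0 \<le> 0"
      then obtain d where d: "0 < d" "\<And>h. 0 < h \<Longrightarrow> h < d \<Longrightarrow> f 0 < f h"
        using has_real_derivative_pos_inc_right[OF f0] by auto
      define h where "h = min \<delta> (d / 2)"
      have h: "0 < h" "h < d" "h \<le> \<delta>" using d(1) dec(1) by (auto simp: h_def)
      then have "f h < f 0" using dec by simp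
      with d(2)[OF h(1,2)] show False by simp
    qed
    show "\<exists>\<epsilon>0>0. \<forall>\<epsilon>. 0 < \<epsilon> \<and> \<epsilon> < \<epsilon>0 \<longrightarrow> (\<forall>\<pi>. \<pi> permutes {1..n} \<and> \<pi> \<noteq> id \<longrightarrow>
        exp_makespan (\<lambda>t. lbar * f t) (task_seq \<epsilon> abar n id) 0
          < exp_makespan (\<lambda>t. lbar * f t) (task_seq \<epsilon> abar n \<pi>) 0)"
    proof (rule exp_makespan_optimal[OF cum abar_pos id])
      fix \<pi> assume \<pi>: "\<pi> permutes {1..n}" "\<pi> \<noteq> id"
      have lt: "order_cost n (\<lambda>i. abar (\<pi> i)) < order_cost n (\<lambda>i. abar (id i))"
        using order_cost_increasing[OF \<pi> abar_pos abar_incr] by simp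
      \<comment> \<open>The denominator is a positive difference of order costs, so the hypothesis
        puts \<open>\<bar>f' 0\<bar>\<close> strictly above a nonnegative number.\<close>
      have "0 \<le> ?N / ((\<Sum>i=1..n. abar i * (\<Sum>k=1..i. abar k)\<^sup>2)
             - (\<Sum>i=1..n. abar (\<pi> i) * (\<Sum>k=1..i. abar (\<pi> k))\<^sup>2))"
        using N lt sum_mult_partial_sum_squared_diff[OF \<pi>(1) id, of abar]
        by (intro divide_nonneg_nonneg) auto
      with bound \<pi> have "0 < \<bar>f' 0\<bar>" by (meson le_less_trans)
      with le lbar_pos have "lbar * f' 0 < 0" by (simp add: mult_pos_neg)
      with lt show "lbar * f' 0 * order_cost n (\<lambda>i. abar (id i)) < lbar * f' 0 * order_cost n (\<lambda>i. abar (\<pi> i))"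
        by (rule mult_strict_left_mono_neg)
    qed
  next
    fix \<delta> :: real
    assume bound: "\<forall>\<pi>. \<pi> permutes {1..n} \<and> \<pi> \<noteq> rev_perm n \<longrightarrow> f' 0 > ?N
          / ((\<Sum>i=1..n. abar (\<pi> i) * (\<Sum>k=1..i. abar (\<pi> k))\<^sup>2)
             - (\<Sum>i=1..n. abar (n + 1 - i) * (\<Sum>k=n+1-i..n. abar k)\<^sup>2))"
    show "\<exists>\<epsilon>0>0. \<forall>\<epsilon>. 0 < \<epsilon> \<and> \<epsilon> < \<epsilon>0 \<longrightarrow> (\<forall>\<pi>. \<pi> permutes {1..n} \<and> \<pi> \<noteq> rev_perm n \<longrightarrow>
        exp_makespan (\<lambda>t. lbar * f t) (task_seq \<epsilon> abar n (rev_perm n)) 0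
          < exp_makespan (\<lambda>t. lbar * f t) (task_seq \<epsilon> abar n \<pi>) 0)"
    proof (rule exp_makespan_optimal[OF cum abar_pos rev_perm_permutes])
      fix \<pi> assume \<pi>: "\<pi> permutes {1..n}" "\<pi> \<noteq> rev_perm n"
      note lt = order_cost_rev_perm[OF \<pi> abar_pos abar_incr]
      \<comment> \<open>The quotient is nonnegative as in the decreasing case; here the bound is on
        \<open>f' 0\<close> itself, so it gives the sign as well.\<close>
      have "0 \<le> ?N / ((\<Sum>i=1..n. abar (\<pi> i) * (\<Sum>k=1..i. abar (\<pi> k))\<^sup>2)
             - (\<Sum>i=1..n. abar (n + 1 - i) * (\<Sum>k=n+1-i..n. abar k)\<^sup>2))"
        unfolding reversed_sum
        using N lt sum_mult_partial_sum_squared_diff[OF rev_perm_permutes \<pi>(1), of abar]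
        by (intro divide_nonneg_nonneg) auto
      with bound \<pi> have "0 < f' 0" by (meson le_less_trans)
      with lbar_pos have "0 < lbar * f' 0" by simp
      with lt show "lbar * f' 0 * order_cost n (\<lambda>i. abar (rev_perm n i)) < lbar * f' 0 * order_cost n (\<lambda>i. abar (\<pi> i))"
        by (rule mult_strict_left_mono)
    qed
  qed
qed

end
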